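(* For $i=1,2$, let $G_i$ be a nilpotent group, let $S_i$ be a symmetric finite generating set of $G_i$, and let $N_i$ be the torsion subgroup of $G_i$ (the set of all elements of finite order, a finite normal subgroup). Let $\varphi$ be a graph isomorphism from $\mathrm{Cay}(G_1;S_1)$ to $\mathrm{Cay}(G_2;S_2)$. Then $\varphi$ induces a well-defined map $\overline\varphi\colon G_1/N_1\to G_2/N_2$, $\overline\varphi(xN_1)=\varphi(x)N_2$, and $\overline\varphi$ is an affine bijection.
   Context: For a group $G$ and a symmetric subset $S$ ($S=S^{-1}$), $\mathrm{Cay}(G;S)$ is the graph with vertex set $G$ in which $g$ is adjacent to $gs$ for all $g\in G$, $s\in S$. A map $\psi\colon H_1\to H_2$ between groups is an affine bijection if there exist a group isomorphism $\alpha\colon H_1\to H_2$ and $h\in H_2$ with $\psi(x)=h\,\alpha(x)$ for all $x\in H_1$. *)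

theory Defs
  imports "HOL-Algebra.Generated_Groups" "Graph_Theory.Pair_Digraph"
begin

text \<open>The term with index \<open>n\<close> is \<open>\<gamma>\<^sub>n\<^sub>+\<^sub>1(G)\<close>, i.e. the series starts at index 0 with \<open>G\<close> itself.\<close>

primrec lower_central_series :: "('a, 'b) monoid_scheme \<Rightarrow> nat \<Rightarrow> 'a set" where
  "lower_central_series G 0 = carrier G"
| "lower_central_series G (Suc n) =
     generate G (\<Union>x \<in> lower_central_series G n. \<Union>g \<in> carrier G.
       {x \<otimes>\<^bsub>G\<^esub> g \<otimes>\<^bsub>G\<^esub> inv\<^bsub>G\<^esub> x \<otimes>\<^bsub>G\<^esub> inv\<^bsub>G\<^esub> g})"

definition nilpotent_group :: "('a, 'b) monoid_scheme \<Rightarrow> bool" where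
  "nilpotent_group G \<longleftrightarrow> group G \<and> (\<exists>n. lower_central_series G n = {\<one>\<^bsub>G\<^esub>})"

definition torsion_subgroup :: "('a, 'b) monoid_scheme \<Rightarrow> 'a set" where
  "torsion_subgroup G = {x \<in> carrier G. \<exists>n::nat. n > 0 \<and> x [^]\<^bsub>G\<^esub> n = \<one>\<^bsub>G\<^esub>}"

definition symmetric_finite_generating_set :: "('a, 'b) monoid_scheme \<Rightarrow> 'a set \<Rightarrow> bool" where
  "symmetric_finite_generating_set G S \<longleftrightarrow>
     S \<subseteq> carrier G \<and> finite S \<and> set_inv\<^bsub>G\<^esub> S = S \<and> generate G S = carrier G"

text \<open>An undirected graph is represented by its vertex set and its adjacency relation; the
  relation below is symmetric when \<open>S\<close> is. There is a loop at every vertex if \<open>\<one> \<in> S\<close>.\<close>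

definition Cay :: "('a, 'b) monoid_scheme \<Rightarrow> 'a set \<Rightarrow> 'a pair_pre_digraph" where
  "Cay G S = \<lparr>pverts = carrier G, parcs = {(g, g \<otimes>\<^bsub>G\<^esub> s) | g s. g \<in> carrier G \<and> s \<in> S}\<rparr>"

text \<open>The isomorphisms of \<open>Digraph_Isomorphism\<close> carry a separate map on arcs; here there are no
  parallel arcs, so an isomorphism is just a map on vertices.\<close>

definition graph_isomorphism ::
    "'a pair_pre_digraph \<Rightarrow> 'b pair_pre_digraph \<Rightarrow> ('a \<Rightarrow> 'b) \<Rightarrow> bool" where
  "graph_isomorphism X Y f \<longleftrightarrow>
     bij_betw f (pverts X) (pverts Y) \<and>
     (\<forall>u \<in> pverts X. \<forall>v \<in> pverts X. (u, v) \<in> parcs X \<longleftrightarrow> (f u, f v) \<in> parcs Y)"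

definition affine_bijection ::
    "('a, 'c) monoid_scheme \<Rightarrow> ('b, 'd) monoid_scheme \<Rightarrow> ('a \<Rightarrow> 'b) \<Rightarrow> bool" where
  "affine_bijection H1 H2 f \<longleftrightarrow>
     (\<exists>\<alpha> \<in> iso H1 H2. \<exists>h \<in> carrier H2. \<forall>x \<in> carrier H1. f x = h \<otimes>\<^bsub>H2\<^esub> \<alpha> x)"

end

theory Submission
  imports Defs "HOL-Algebra.Multiplicative_Group" "HOL-Algebra.Zassenhaus"
begin

text \<open>
  Let \<open>Z\<^sub>0\<close> be the torsion subgroup of \<open>G\<close> and let \<open>Z\<^sub>i\<^sub>+\<^sub>1\<close> be the preimage of the centre of \<open>G/Z\<^sub>i\<close>;
  all quotients \<open>G/Z\<^sub>i\<close> are torsion-free, and \<open>Z\<^sub>n = G\<close> for some \<open>n\<close>.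

  The key point is that an automorphism \<open>\<psi>\<close> of the Cayley graph for which \<open>x\<^sup>-\<^sup>1 \<psi>(x)\<close> takes only
  finitely many values modulo \<open>Z\<^sub>i\<close> is a right translation modulo \<open>Z\<^sub>i\<close>, by the element \<open>e = \<psi>(1)\<close>,
  which lies in \<open>Z\<^sub>i\<^sub>+\<^sub>1\<close>. Going down from \<open>Z\<^sub>n\<close>, suppose that \<open>\<psi>(x) = xe\<close> modulo \<open>Z\<^sub>j\<^sub>+\<^sub>1\<close>. Conjugation by \<open>e\<close>
  permutes the finite set \<open>S\<close> modulo \<open>Z\<^sub>j\<^sub>+\<^sub>1\<close>, so a power of \<open>e\<close>, and hence \<open>e\<close> itself, is central there.
  It follows that \<open>(xe)\<^sup>-\<^sup>1 \<psi>(x)\<close> is a harmonic function with finitely many values in the torsion-free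
  abelian group \<open>Z\<^sub>j\<^sub>+\<^sub>1/Z\<^sub>j\<close>, and the maximum principle at an extreme value shows that it is constant.

  Applied to \<open>\<phi> L\<^sub>g \<phi>\<^sup>-\<^sup>1\<close>, where \<open>L\<^sub>g\<close> is the left translation by an element \<open>g\<close> of the torsion subgroup or
  of the next term of the series, this shows successively that \<open>\<phi>\<close> maps cosets of each term to cosets
  of the corresponding term, and that \<open>\<phi>(x)\<^sup>-\<^sup>1 \<phi>(xg)\<close> is independent of \<open>x\<close> modulo \<open>Z\<^sub>i\<close> for \<open>g\<close> in
  \<open>Z\<^sub>i\<^sub>+\<^sub>1\<close>. For a generator \<open>s\<close> that is known to have this property modulo \<open>Z\<^sub>i\<^sub>+\<^sub>1\<close>, a product over the
  generators in the coset \<open>s Z\<^sub>i\<^sub>+\<^sub>1\<close> yields it modulo \<open>Z\<^sub>i\<close>. The case \<open>i = 0\<close> says that \<open>\<phi>\<close> is affine modulo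
  torsion.
\<close>

section \<open>Quotients, commutators and centralizers\<close>

declare mult_FactGroup [simp del] and one_FactGroup [simp del]

sublocale normal \<subseteq> quot: group_hom G "G Mod H" "r_coset G H"
  using factorgroup_is_group r_coset_hom_Mod by (simp add: group_hom_def group_hom_axioms_def)

definition commutator :: "('a, 'b) monoid_scheme \<Rightarrow> 'a \<Rightarrow> 'a \<Rightarrow> 'a" where
  "commutator G x y = x \<otimes>\<^bsub>G\<^esub> y \<otimes>\<^bsub>G\<^esub> inv\<^bsub>G\<^esub> x \<otimes>\<^bsub>G\<^esub> inv\<^bsub>G\<^esub> y"

definition centralizer :: "('a, 'b) monoid_scheme \<Rightarrow> 'a set \<Rightarrow> 'a set" where
  "centralizer G A = {z \<in> carrier G. \<forall>x \<in> A. z \<otimes>\<^bsub>G\<^esub> x = x \<otimes>\<^bsub>G\<^esub> z}"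

abbreviation center :: "('a, 'b) monoid_scheme \<Rightarrow> 'a set" where
  "center G \<equiv> centralizer G (carrier G)"

abbreviation center_group :: "('a, 'b) monoid_scheme \<Rightarrow> ('a, 'b) monoid_scheme" where
  "center_group G \<equiv> G\<lparr>carrier := center G\<rparr>"

context group
begin

lemma inv_mult_cancel [simp]: "x \<in> carrier G \<Longrightarrow> y \<in> carrier G \<Longrightarrow> inv x \<otimes> (x \<otimes> y) = y"
  by (simp flip: m_assoc)

lemma mult_inv_cancel [simp]: "x \<in> carrier G \<Longrightarrow> y \<in> carrier G \<Longrightarrow> x \<otimes> (inv x \<otimes> y) = y"
  by (simp flip: m_assoc)

lemma commutator_closed [simp]:
  "x \<in> carrier G \<Longrightarrow> y \<in> carrier G \<Longrightarrow> commutator G x y \<in> carrier G"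
  by (simp add: commutator_def)

lemma commutator_mult:
  "x \<in> carrier G \<Longrightarrow> y \<in> carrier G \<Longrightarrow> commutator G x y \<otimes> (y \<otimes> x) = x \<otimes> y"
  by (simp add: commutator_def m_assoc)

lemma inv_commutator:
  "x \<in> carrier G \<Longrightarrow> y \<in> carrier G \<Longrightarrow> inv (commutator G x y) = commutator G y x"
  by (simp add: commutator_def inv_mult_group m_assoc)

lemma commutator_eq_one_iff:
  assumes "x \<in> carrier G" "y \<in> carrier G"
  shows "commutator G x y = \<one> \<longleftrightarrow> x \<otimes> y = y \<otimes> x"
  using assms commutator_mult[OF assms] r_cancel_one[of "y \<otimes> x" "commutator G x y"] by force

lemma commutator_mem_sym:
  assumes "subgroup K G" "x \<in> carrier G" "y \<in> carrier G" "commutator G x y \<in> K"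
  shows "commutator G y x \<in> K"
  using subgroup.m_inv_closed[OF assms(1,4)] assms(2,3) by (simp add: inv_commutator)

lemma commutator_conj:
  assumes "g \<in> carrier G" "x \<in> carrier G" "y \<in> carrier G"
  shows "g \<otimes> commutator G x y \<otimes> inv g = commutator G (g \<otimes> x \<otimes> inv g) (g \<otimes> y \<otimes> inv g)"
  using assms by (simp add: commutator_def inv_mult_group m_assoc)

lemma centralizer_subgroup:
  assumes "A \<subseteq> carrier G"
  shows "subgroup (centralizer G A) G"
proof (rule subgroupI)
  show "centralizer G A \<subseteq> carrier G" unfolding centralizer_def by blast
  show "centralizer G A \<noteq> {}" using assms by (auto simp: centralizer_def intro!: exI[of _ \<one>])
next
  fix z assume z: "z \<in> centralizer G A"
  have "inv z \<otimes> x = x \<otimes> inv z" if "x \<in> A" for x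
  proof -
    have in_carrier: "z \<in> carrier G" "x \<in> carrier G" and zx: "z \<otimes> x = x \<otimes> z"
      using z that assms unfolding centralizer_def by auto
    have "z \<otimes> (x \<otimes> inv z) = (x \<otimes> z) \<otimes> inv z"
      unfolding zx[symmetric] using in_carrier by (simp add: m_assoc)
    also have "\<dots> = x" using in_carrier by (simp add: m_assoc)
    finally have "z \<otimes> (x \<otimes> inv z) = x" .
    then show ?thesis using in_carrier by (simp add: inv_solve_left')
  qed
  then show "inv z \<in> centralizer G A" using z by (simp add: centralizer_def)
next
  fix z w assume zw: "z \<in> centralizer G A" "w \<in> centralizer G A"
  have "z \<otimes> w \<otimes> x = x \<otimes> (z \<otimes> w)" if "x \<in> A" for x
  proof -
    have in_carrier: "z \<in> carrier G" "w \<in> carrier G" "x \<in> carrier G"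
      and zx: "z \<otimes> x = x \<otimes> z" and wx: "w \<otimes> x = x \<otimes> w"
      using zw that assms unfolding centralizer_def by auto
    have "z \<otimes> w \<otimes> x = (z \<otimes> x) \<otimes> w" using in_carrier wx by (simp add: m_assoc)
    then show ?thesis unfolding zx using in_carrier by (simp add: m_assoc)
  qed
  then show "z \<otimes> w \<in> centralizer G A" using zw by (simp add: centralizer_def)
qed

lemma centralizer_generate:
  assumes "A \<subseteq> carrier G"
  shows "centralizer G (generate G A) = centralizer G A"
proof
  show "centralizer G (generate G A) \<subseteq> centralizer G A"
    unfolding centralizer_def using generate.incl[of _ A G] by blast
  show "centralizer G A \<subseteq> centralizer G (generate G A)"
  proof
    fix z assume z: "z \<in> centralizer G A"
    then have "A \<subseteq> centralizer G {z}" using assms unfolding centralizer_def by auto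
    then have "generate G A \<subseteq> centralizer G {z}"
      using z by (intro generate_subgroup_incl centralizer_subgroup) (auto simp: centralizer_def)
    then show "z \<in> centralizer G (generate G A)"
      using z unfolding centralizer_def by auto
  qed
qed

lemma center_subset: "center G \<subseteq> carrier G"
  unfolding centralizer_def by blast

lemma center_commute: "z \<in> center G \<Longrightarrow> x \<in> carrier G \<Longrightarrow> z \<otimes> x = x \<otimes> z"
  unfolding centralizer_def by blast

lemma center_comm_group: "comm_group (center_group G)"
proof (rule group.group_comm_groupI)
  show "group (center_group G)"
    by (simp add: centralizer_subgroup subgroup_imp_group)
qed (use center_commute center_subset in auto)

lemma center_normal: "center G \<lhd> G"
proof (rule normal_invI)
  fix x z assume x: "x \<in> carrier G" and z: "z \<in> center G"
  have "x \<otimes> z \<otimes> inv x = z \<otimes> x \<otimes> inv x" using center_commute[OF z x] by simp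
  also have "\<dots> = z" using x z center_subset by (simp add: m_assoc subset_iff)
  finally have "x \<otimes> z \<otimes> inv x = z" .
  with z show "x \<otimes> z \<otimes> inv x \<in> center G" by simp
qed (simp add: centralizer_subgroup)

lemma commutator_inv_left_if_center:
  assumes x: "x \<in> carrier G" and y: "y \<in> carrier G" and comm: "commutator G x y \<in> center G"
  shows "commutator G (inv x) y = inv (commutator G x y)"
proof -
  have "commutator G (inv x) y = inv x \<otimes> (inv (commutator G x y) \<otimes> x)"
    using x y by (simp add: inv_commutator) (simp add: commutator_def m_assoc)
  also have "inv (commutator G x y) \<otimes> x = x \<otimes> inv (commutator G x y)"
    using comm x by (intro center_commute subgroup.m_inv_closed[OF centralizer_subgroup]) auto
  also have "inv x \<otimes> (x \<otimes> inv (commutator G x y)) = inv (commutator G x y)"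
    using x y by simp
  finally show ?thesis .
qed

end

lemma (in group_hom) hom_commutator:
  "x \<in> carrier G \<Longrightarrow> y \<in> carrier G \<Longrightarrow> h (commutator G x y) = commutator H (h x) (h y)"
  by (simp add: commutator_def)

context normal
begin

lemma r_coset_eq_one_iff: "x \<in> carrier G \<Longrightarrow> H #> x = \<one>\<^bsub>G Mod H\<^esub> \<longleftrightarrow> x \<in> H"
  unfolding one_FactGroup using coset_join1 coset_join2 subgroup_axioms by blast

lemma r_coset_eq_iff:
  assumes "x \<in> carrier G" "y \<in> carrier G"
  shows "H #> x = H #> y \<longleftrightarrow> inv x \<otimes> y \<in> H"
proof -
  have "H #> x = H #> y \<longleftrightarrow> H #> (inv x \<otimes> y) = \<one>\<^bsub>G Mod H\<^esub>"
    using assms quot.H.inv_solve_left'[of "\<one>\<^bsub>G Mod H\<^esub>" "H #> x" "H #> y"] by auto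
  then show ?thesis using assms by (simp add: r_coset_eq_one_iff del: quot.hom_mult)
qed

lemma r_coset_mult_mem: "x \<in> carrier G \<Longrightarrow> k \<in> H \<Longrightarrow> H #> (x \<otimes> k) = H #> x"
  using r_coset_eq_one_iff[of k] by simp

lemma commutator_mem_iff:
  assumes "x \<in> carrier G" "y \<in> carrier G"
  shows "commutator G x y \<in> H \<longleftrightarrow> (H #> x) \<otimes>\<^bsub>G Mod H\<^esub> (H #> y) = (H #> y) \<otimes>\<^bsub>G Mod H\<^esub> (H #> x)"
  using assms r_coset_eq_one_iff[of "commutator G x y"]
  by (simp add: quot.hom_commutator quot.H.commutator_eq_one_iff)

end

section \<open>Central series\<close>

definition central_modulo :: "('a, 'b) monoid_scheme \<Rightarrow> 'a set \<Rightarrow> 'a set" where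
  "central_modulo G K = {g \<in> carrier G. \<forall>x \<in> carrier G. commutator G g x \<in> K}"

primrec upper_central_series :: "('a, 'b) monoid_scheme \<Rightarrow> 'a set \<Rightarrow> nat \<Rightarrow> 'a set" where
  "upper_central_series G K 0 = K"
| "upper_central_series G K (Suc n) = central_modulo G (upper_central_series G K n)"

declare upper_central_series.simps [simp del] and lower_central_series.simps(2) [simp del]

lemma central_modulo_mono: "K \<subseteq> L \<Longrightarrow> central_modulo G K \<subseteq> central_modulo G L"
  unfolding central_modulo_def by blast

lemma central_modulo_closed: "g \<in> central_modulo G K \<Longrightarrow> g \<in> carrier G"
  by (simp add: central_modulo_def)

lemma (in group_hom) subgroup_vimage:
  assumes "subgroup K H"
  shows "subgroup {x \<in> carrier G. h x \<in> K} G"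
proof -
  interpret K: subgroup K H by fact
  show ?thesis by (rule G.subgroupI) (auto intro: exI[of _ \<one>])
qed

context normal
begin

lemma commutator_mem: "k \<in> H \<Longrightarrow> x \<in> carrier G \<Longrightarrow> commutator G k x \<in> H"
  using commutator_mem_iff[of k x] r_coset_eq_one_iff[of k] by simp

lemma subset_central_modulo: "H \<subseteq> central_modulo G H"
  unfolding central_modulo_def using commutator_mem by auto

lemma central_modulo_eq_vimage_center:
  "central_modulo G H = {g \<in> carrier G. H #> g \<in> center (G Mod H)}"
  unfolding central_modulo_def centralizer_def carrier_FactGroup by (auto simp: commutator_mem_iff)

lemma normal_if_central_modulo:
  assumes M: "subgroup M G" and "H \<subseteq> M" "M \<subseteq> central_modulo G H"
  shows "M \<lhd> G"
proof (rule normal_invI[OF M])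
  fix x m assume x: "x \<in> carrier G" and m: "m \<in> M"
  then have m_carrier: "m \<in> carrier G" using subgroup.mem_carrier[OF M] by blast
  have "commutator G m x \<in> H" using assms(3) m x unfolding central_modulo_def by blast
  then have "commutator G x m \<in> M"
    using commutator_mem_sym[OF subgroup_axioms m_carrier x] assms(2) by blast
  then have "commutator G x m \<otimes> m \<in> M" using m by (rule subgroup.m_closed[OF M])
  then show "x \<otimes> m \<otimes> inv x \<in> M" using x m_carrier by (simp add: commutator_def m_assoc)
qed

lemma central_modulo_normal: "central_modulo G H \<lhd> G"
proof (rule normal_if_central_modulo)
  show "subgroup (central_modulo G H) G"
    unfolding central_modulo_eq_vimage_center
    by (intro quot.subgroup_vimage quot.H.centralizer_subgroup order_refl)
qed (use subset_central_modulo in auto)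

lemma mem_central_modulo_if_generators:
  assumes S: "S \<subseteq> carrier G" "generate G S = carrier G"
    and x: "x \<in> carrier G" and "\<And>s. s \<in> S \<Longrightarrow> commutator G x s \<in> H"
  shows "x \<in> central_modulo G H"
proof -
  have "H #> x \<in> centralizer (G Mod H) ((#>) H ` S)"
    using assms commutator_mem_iff[OF x] unfolding centralizer_def by (auto simp: subset_iff)
  also have "centralizer (G Mod H) ((#>) H ` S) = center (G Mod H)"
    using S quot.generate_img[OF S(1)] quot.H.centralizer_generate[of "(#>) H ` S"]
    by (auto simp: carrier_FactGroup)
  finally show ?thesis unfolding central_modulo_eq_vimage_center using x by blast
qed

end

context group
begin

lemma upper_central_series_normal: "K \<lhd> G \<Longrightarrow> upper_central_series G K n \<lhd> G"
  by (induction n) (simp_all add: upper_central_series.simps normal.central_modulo_normal)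

lemma upper_central_series_mono:
  assumes "K \<lhd> G" "i \<le> j"
  shows "upper_central_series G K i \<subseteq> upper_central_series G K j"
proof (rule lift_Suc_mono_le[OF _ assms(2)])
  show "upper_central_series G K n \<subseteq> upper_central_series G K (Suc n)" for n
    using normal.subset_central_modulo[OF upper_central_series_normal[OF assms(1)]]
    by (simp add: upper_central_series.simps)
qed

lemma lower_central_series_subset: "lower_central_series G n \<subseteq> carrier G"
proof (induction n)
  case (Suc n)
  then show ?case unfolding lower_central_series.simps by (intro generate_incl) auto
qed simp

lemma lower_central_series_subset_central_modulo:
  "lower_central_series G n \<subseteq> central_modulo G (lower_central_series G (Suc n))"
proof
  fix x assume x: "x \<in> lower_central_series G n"
  have "commutator G x g \<in> lower_central_series G (Suc n)" if "g \<in> carrier G" for g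
    unfolding lower_central_series.simps commutator_def using x that by (intro generate.incl) blast
  then show "x \<in> central_modulo G (lower_central_series G (Suc n))"
    using x lower_central_series_subset unfolding central_modulo_def by blast
qed

lemma lower_central_series_Suc_subset_if_central:
  assumes "subgroup M G" "lower_central_series G n \<subseteq> central_modulo G M"
  shows "lower_central_series G (Suc n) \<subseteq> M"
  unfolding lower_central_series.simps using assms(2)
  by (intro generate_subgroup_incl[OF _ assms(1)]) (auto simp: central_modulo_def commutator_def)

lemma lower_central_series_normal: "lower_central_series G n \<lhd> G"
proof (induction n)
  case 0
  show ?case by (simp add: normal_self)
next
  case (Suc n)
  let ?L = "lower_central_series G"
  let ?C = "\<Union>x \<in> ?L n. \<Union>g \<in> carrier G. {commutator G x g}"
  have sub: "?L n \<subseteq> carrier G" by (rule lower_central_series_subset)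
  have "h \<otimes> c \<otimes> inv h \<in> ?C" if "c \<in> ?C" and h: "h \<in> carrier G" for c h
  proof -
    from that obtain x g where x: "x \<in> ?L n" and g: "g \<in> carrier G" and "c = commutator G x g" by blast
    then have "h \<otimes> c \<otimes> inv h = commutator G (h \<otimes> x \<otimes> inv h) (h \<otimes> g \<otimes> inv h)"
      using sub h by (simp add: commutator_conj subset_iff)
    moreover have "h \<otimes> x \<otimes> inv h \<in> ?L n" by (rule normal.inv_op_closed2[OF Suc.IH h x])
    ultimately show ?thesis using g h by auto
  qed
  then have "generate G ?C \<lhd> G"
    using sub by (intro normal_generateI) (auto simp: subset_iff)
  then show ?case unfolding lower_central_series.simps commutator_def .
qed

lemma upper_central_series_eq_carrier:
  assumes K: "K \<lhd> G" and n: "lower_central_series G n = {\<one>}"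
  shows "upper_central_series G K n = carrier G"
proof -
  let ?L = "lower_central_series G" and ?U = "upper_central_series G K"
  have "?L (n - i) \<subseteq> ?U i" if "i \<le> n" for i
    using that
  proof (induction i)
    case 0
    show ?case using n subgroup.one_closed[OF normal_imp_subgroup[OF K]]
      by (simp add: upper_central_series.simps)
  next
    case (Suc i)
    then have "n - i = Suc (n - Suc i)" by simp
    then have "?L (n - Suc i) \<subseteq> central_modulo G (?L (n - i))"
      using lower_central_series_subset_central_modulo by metis
    also have "\<dots> \<subseteq> ?U (Suc i)" using Suc by (simp add: upper_central_series.simps central_modulo_mono)
    finally show ?case .
  qed
  from this[of n] show ?thesis
    using subgroup.subset[OF normal_imp_subgroup[OF upper_central_series_normal[OF K]]] by auto
qed

lemma nilpotent_upper_central_series: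
  "nilpotent_group G \<Longrightarrow> K \<lhd> G \<Longrightarrow> \<exists>n. upper_central_series G K n = carrier G"
  unfolding nilpotent_group_def using upper_central_series_eq_carrier by blast

end

section \<open>Torsion\<close>

definition torsion_free :: "('a, 'b) monoid_scheme \<Rightarrow> bool" where
  "torsion_free G \<longleftrightarrow> torsion_subgroup G = {\<one>\<^bsub>G\<^esub>}"

context group
begin

lemma torsion_subgroup_iff_ord: "x \<in> torsion_subgroup G \<longleftrightarrow> x \<in> carrier G \<and> ord x \<noteq> 0"
  unfolding torsion_subgroup_def using ord_eq_0[of x] by auto

lemma torsion_subgroup_subset: "torsion_subgroup G \<subseteq> carrier G"
  unfolding torsion_subgroup_def by blast

lemma one_mem_torsion_subgroup: "\<one> \<in> torsion_subgroup G"
  by (simp add: torsion_subgroup_iff_ord)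

lemma torsion_subgroup_root:
  assumes "y \<in> carrier G" "m > (0::nat)" "y [^] m \<in> torsion_subgroup G"
  shows "y \<in> torsion_subgroup G"
proof -
  obtain n :: nat where "n > 0" "(y [^] m) [^] n = \<one>"
    using assms(3) unfolding torsion_subgroup_def by blast
  then have "m * n > 0" "y [^] (m * n) = \<one>" using assms nat_pow_pow by auto
  then show ?thesis using assms(1) unfolding torsion_subgroup_def by blast
qed

lemma nat_pow_conj:
  assumes "x \<in> carrier G" "a \<in> carrier G"
  shows "(x \<otimes> a \<otimes> inv x) [^] (n::nat) = x \<otimes> a [^] n \<otimes> inv x"
proof (induction n)
  case (Suc n)
  have "x \<otimes> a [^] n \<otimes> inv x \<otimes> (x \<otimes> a \<otimes> inv x) = x \<otimes> (a [^] n \<otimes> a) \<otimes> inv x"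
    using assms by (simp add: m_assoc)
  with Suc show ?case using assms by simp
qed (use assms in simp)

lemma torsion_subgroup_conj:
  assumes x: "x \<in> carrier G" and a: "a \<in> torsion_subgroup G"
  shows "x \<otimes> a \<otimes> inv x \<in> torsion_subgroup G"
proof -
  obtain n :: nat where "n > 0" "a [^] n = \<one>" and "a \<in> carrier G"
    using a unfolding torsion_subgroup_def by blast
  then show ?thesis
    using x by (auto simp: torsion_subgroup_def nat_pow_conj intro!: exI[of _ n])
qed

lemma torsion_freeD:
  "torsion_free G \<Longrightarrow> x \<in> carrier G \<Longrightarrow> n > (0::nat) \<Longrightarrow> x [^] n = \<one> \<Longrightarrow> x = \<one>"
  unfolding torsion_free_def torsion_subgroup_def by blast

lemma torsion_free_subgroup:
  assumes "torsion_free G" "subgroup H G"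
  shows "torsion_free (G\<lparr>carrier := H\<rparr>)"
  unfolding torsion_free_def torsion_subgroup_def
  using torsion_freeD[OF assms(1)] subgroup.mem_carrier[OF assms(2)] subgroup.one_closed[OF assms(2)]
  by (auto simp flip: nat_pow_consistent intro!: exI[of _ "1::nat"])

lemma torsion_free_pow_inject:
  assumes "torsion_free G" and x: "x \<in> carrier G" and y: "y \<in> carrier G" and "x \<otimes> y = y \<otimes> x"
    and "n > (0::nat)" "x [^] n = y [^] n"
  shows "x = y"
proof -
  have "x \<otimes> inv y = inv y \<otimes> x"
    using assms(4) x y by (metis inv_closed inv_solve_left inv_solve_right m_assoc m_closed)
  then have "(x \<otimes> inv y) [^] n = \<one>"
    using assms(6) x y by (simp add: pow_mult_distrib nat_pow_inv)
  then have "x \<otimes> inv y = \<one>" using torsion_freeD[OF assms(1) _ assms(5)] x y by simp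
  then show ?thesis using x y inv_equality[of x "inv y"] by simp
qed

text \<open>Conjugation by \<open>a\<close> takes \<open>x\<close> to \<open>[a, x] x\<close> and fixes \<open>[a, x]\<close>, so that iterating it \<open>n\<close> times gives
  \<open>[a, x]\<^sup>n x\<close>.\<close>

lemma commutator_pow_left:
  assumes a: "a \<in> carrier G" and x: "x \<in> carrier G"
    and comm: "a \<otimes> commutator G a x = commutator G a x \<otimes> a"
  shows "commutator G (a [^] (n::nat)) x = commutator G a x [^] n"
proof -
  define y where "y = commutator G a x"
  have y: "y \<in> carrier G" unfolding y_def using a x by simp
  have ax: "a \<otimes> x = y \<otimes> x \<otimes> a" unfolding y_def using a x commutator_mult[OF a x] by (simp add: m_assoc)
  have "a [^] n \<otimes> x = y [^] n \<otimes> x \<otimes> a [^] n"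
  proof (induction n)
    case (Suc n)
    have "a [^] Suc n \<otimes> x = (a [^] n \<otimes> y) \<otimes> x \<otimes> a" using a x y ax by (simp add: m_assoc)
    also have "a [^] n \<otimes> y = y \<otimes> a [^] n" using comm a y unfolding y_def by (rule group_commutes_pow)
    also have "y \<otimes> a [^] n \<otimes> x \<otimes> a = y \<otimes> (a [^] n \<otimes> x) \<otimes> a" using a x y by (simp add: m_assoc)
    also have "\<dots> = (y \<otimes> y [^] n) \<otimes> x \<otimes> (a [^] n \<otimes> a)" unfolding Suc using a x y by (simp add: m_assoc)
    also have "y \<otimes> y [^] n = y [^] Suc n" using nat_pow_Suc2[OF y] by simp
    finally show ?case by simp
  qed (use x in simp)
  then show ?thesis unfolding commutator_def[of G "a [^] n"] y_def[symmetric]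
    using a x y by (simp add: m_assoc)
qed

end

context normal
begin

lemma torsion_free_quot_iff:
  "torsion_free (G Mod H) \<longleftrightarrow> (\<forall>x \<in> carrier G. \<forall>n > (0::nat). x [^] n \<in> H \<longrightarrow> x \<in> H)"
proof -
  have "torsion_free (G Mod H) \<longleftrightarrow> (\<forall>X \<in> carrier (G Mod H). \<forall>n > (0::nat).
      X [^]\<^bsub>G Mod H\<^esub> n = \<one>\<^bsub>G Mod H\<^esub> \<longrightarrow> X = \<one>\<^bsub>G Mod H\<^esub>)"
    using quot.H.one_mem_torsion_subgroup unfolding torsion_free_def torsion_subgroup_def by blast
  also have "\<dots> \<longleftrightarrow> (\<forall>x \<in> carrier G. \<forall>n > (0::nat). x [^] n \<in> H \<longrightarrow> x \<in> H)"
    by (auto simp: carrier_FactGroup r_coset_eq_one_iff FactGroup_pow)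
  finally show ?thesis .
qed

lemma torsion_subgroup_mult_closed:
  assumes H: "H \<subseteq> torsion_subgroup G" and a: "a \<in> torsion_subgroup G" and b: "b \<in> torsion_subgroup G"
    and comm: "commutator G a b \<in> H"
  shows "a \<otimes> b \<in> torsion_subgroup G"
proof -
  have in_carrier: "a \<in> carrier G" "b \<in> carrier G" using a b torsion_subgroup_subset by auto
  define n where "n = ord a * ord b"
  have "(H #> a) \<otimes>\<^bsub>G Mod H\<^esub> (H #> b) = (H #> b) \<otimes>\<^bsub>G Mod H\<^esub> (H #> a)"
    using comm in_carrier commutator_mem_iff by blast
  then have "H #> (a \<otimes> b) [^] n = (H #> a [^] n) \<otimes>\<^bsub>G Mod H\<^esub> (H #> b [^] n)"
    using in_carrier quot.H.pow_mult_distrib[of "H #> a" "H #> b" n] by (simp add: quot.hom_nat_pow)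
  also have "a [^] n = \<one>" unfolding n_def using in_carrier by (simp add: pow_eq_id)
  also have "b [^] n = \<one>" unfolding n_def using in_carrier by (simp add: pow_eq_id)
  finally have "(a \<otimes> b) [^] n \<in> H" using in_carrier r_coset_eq_one_iff[of "(a \<otimes> b) [^] n"] by simp
  moreover have "n > 0" using a b unfolding n_def by (simp add: torsion_subgroup_iff_ord)
  ultimately show ?thesis using torsion_subgroup_root[of "a \<otimes> b" n] H in_carrier by blast
qed

lemma pow_commutator_mem:
  assumes a: "a \<in> carrier G" and x: "x \<in> carrier G" and pow_central: "a [^] (n::nat) \<in> central_modulo G H"
    and comm: "commutator G a (commutator G a x) \<in> H"
  shows "commutator G a x [^] n \<in> H"
proof -
  let ?A = "H #> a" and ?X = "H #> x"
  have "?A \<otimes>\<^bsub>G Mod H\<^esub> commutator (G Mod H) ?A ?X = commutator (G Mod H) ?A ?X \<otimes>\<^bsub>G Mod H\<^esub> ?A"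
    using comm a x by (simp add: commutator_mem_iff quot.hom_commutator)
  then have "commutator (G Mod H) ?A ?X [^]\<^bsub>G Mod H\<^esub> n = commutator (G Mod H) (?A [^]\<^bsub>G Mod H\<^esub> n) ?X"
    using a x by (simp add: quot.H.commutator_pow_left)
  also have "\<dots> = H #> commutator G (a [^] n) x"
    using a x by (simp add: quot.hom_commutator quot.hom_nat_pow)
  also have "\<dots> = \<one>\<^bsub>G Mod H\<^esub>"
    using pow_central a x by (simp add: r_coset_eq_one_iff central_modulo_def)
  finally have "H #> (commutator G a x [^] n) = \<one>\<^bsub>G Mod H\<^esub>"
    using a x by (simp add: quot.hom_commutator quot.hom_nat_pow)
  then show ?thesis using a x r_coset_eq_one_iff by simp
qed

lemma commutator_mem_if_pow_central:
  assumes a: "a \<in> carrier G" and n: "n > (0::nat)" and pow_central: "a [^] n \<in> central_modulo G H"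
    and "\<And>y m. y \<in> upper_central_series G {\<one>} i \<Longrightarrow> m > (0::nat) \<Longrightarrow> y [^] m \<in> H \<Longrightarrow> y \<in> H"
    and "x \<in> upper_central_series G {\<one>} (Suc i)"
  shows "commutator G a x \<in> H"
  using assms(4,5)
proof (induction i arbitrary: x)
  let ?Z = "upper_central_series G {\<one>}"
  have Z: "x \<in> carrier G \<and> commutator G a x \<in> ?Z i" if "x \<in> ?Z (Suc i)" for x i
  proof -
    have x: "x \<in> carrier G" and "commutator G x a \<in> ?Z i"
      using that a by (auto simp: upper_central_series.simps central_modulo_def)
    then show ?thesis
      using commutator_mem_sym[OF normal_imp_subgroup[OF upper_central_series_normal[OF one_is_normal]] x a]
      by blast
  qed
  {
    case 0
    then show ?case using Z[of x 0] one_closed by (simp add: upper_central_series.simps)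
  next
    case (Suc i)
    have x: "x \<in> carrier G" and y: "commutator G a x \<in> ?Z (Suc i)" using Z Suc.prems(2) by auto
    have "y \<in> H" if "y \<in> ?Z i" "m > 0" "y [^] m \<in> H" for y and m :: nat
      using Suc.prems(1) that upper_central_series_mono[OF one_is_normal, of i "Suc i"] by auto
    then have "commutator G a (commutator G a x) \<in> H" using y by (rule Suc.IH)
    then have "commutator G a x [^] n \<in> H" by (rule pow_commutator_mem[OF a x pow_central])
    with y n show ?case by (rule Suc.prems(1))
  }
qed

end

context group
begin

lemma torsion_Int_upper_central_series_normal:
  "torsion_subgroup G \<inter> upper_central_series G {\<one>} i \<lhd> G"
proof (induction i)
  case 0
  have "torsion_subgroup G \<inter> {\<one>} = {\<one>}" using one_mem_torsion_subgroup by blast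
  then show ?case using one_is_normal by (simp add: upper_central_series.simps)
next
  case (Suc i)
  let ?Z = "upper_central_series G {\<one>}" and ?T = "torsion_subgroup G"
  interpret K: normal "?T \<inter> ?Z i" G by (rule Suc.IH)
  interpret Z: normal "?Z (Suc i)" G by (rule upper_central_series_normal[OF one_is_normal])
  have mult: "a \<otimes> b \<in> ?T" if a: "a \<in> ?T" and b: "b \<in> ?T" "b \<in> ?Z (Suc i)" for a b
  proof (rule K.torsion_subgroup_mult_closed[OF _ a b(1)])
    have ord: "ord a > 0" "a \<in> carrier G" using a by (auto simp: torsion_subgroup_iff_ord)
    then have pow: "a [^] ord a \<in> central_modulo G (?T \<inter> ?Z i)"
      using K.one_closed K.subset_central_modulo by auto
    show "commutator G a b \<in> ?T \<inter> ?Z i"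
    proof (rule K.commutator_mem_if_pow_central[OF ord(2,1) pow _ b(2)])
      fix y m assume "y \<in> ?Z i" "m > (0::nat)" "y [^] m \<in> ?T \<inter> ?Z i"
      moreover have "?Z i \<subseteq> carrier G"
        using upper_central_series_normal[OF one_is_normal] normal_imp_subgroup subgroup.subset by blast
      ultimately show "y \<in> ?T \<inter> ?Z i" using torsion_subgroup_root[of y m] by blast
    qed
  qed simp
  show ?case
  proof (rule normal_invI)
    show "subgroup (?T \<inter> ?Z (Suc i)) G"
    proof (rule subgroupI)
      show "?T \<inter> ?Z (Suc i) \<noteq> {}" using one_mem_torsion_subgroup Z.one_closed by blast
    qed (auto simp: mult torsion_subgroup_iff_ord[of "inv _"] torsion_subgroup_subset[THEN subsetD]
        dest: torsion_subgroup_iff_ord[THEN iffD1])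
  qed (use torsion_subgroup_conj Z.inv_op_closed2 in auto)
qed

lemma torsion_subgroup_normal:
  assumes "nilpotent_group G"
  shows "torsion_subgroup G \<lhd> G"
proof -
  obtain n where "upper_central_series G {\<one>} n = carrier G"
    using nilpotent_upper_central_series[OF assms one_is_normal] by blast
  then show ?thesis
    using torsion_Int_upper_central_series_normal[of n] torsion_subgroup_subset by (simp add: inf_absorb1)
qed

lemma torsion_free_Mod_torsion:
  assumes "torsion_subgroup G \<lhd> G"
  shows "torsion_free (G Mod torsion_subgroup G)"
  using normal.torsion_free_quot_iff[OF assms] torsion_subgroup_root by blast

lemma torsion_free_Mod_central_modulo:
  assumes nil: "nilpotent_group G" and K: "K \<lhd> G" and tf: "torsion_free (G Mod K)"
  shows "torsion_free (G Mod central_modulo G K)"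
proof -
  interpret K: normal K G by (rule K)
  obtain n where n: "upper_central_series G {\<one>} n = carrier G"
    using nilpotent_upper_central_series[OF nil one_is_normal] by blast
  then have nSuc: "upper_central_series G {\<one>} (Suc n) = carrier G"
    using upper_central_series_mono[OF one_is_normal, of n "Suc n"] central_modulo_closed
    by (auto simp: upper_central_series.simps)
  have "y \<in> central_modulo G K"
    if y: "y \<in> carrier G" "m > (0::nat)" "y [^] m \<in> central_modulo G K" for y m
  proof -
    have "commutator G y x \<in> K" if x: "x \<in> carrier G" for x
    proof (rule K.commutator_mem_if_pow_central[OF y])
      show "z \<in> K" if "z \<in> upper_central_series G {\<one>} n" "k > 0" "z [^] k \<in> K" for z and k :: nat
        using tf that unfolding K.torsion_free_quot_iff n by blast
      show "x \<in> upper_central_series G {\<one>} (Suc n)" unfolding nSuc by (rule x)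
    qed
    then show ?thesis using y(1) by (simp add: central_modulo_def)
  qed
  then show ?thesis using normal.torsion_free_quot_iff[OF K.central_modulo_normal] by blast
qed

lemma torsion_free_Mod_upper_central_series:
  assumes "nilpotent_group G" "K \<lhd> G" "torsion_free (G Mod K)"
  shows "torsion_free (G Mod upper_central_series G K n)"
  using assms
  by (induction n) (simp_all add: upper_central_series.simps torsion_free_Mod_central_modulo
      upper_central_series_normal)

end

section \<open>Finiteness of the torsion subgroup\<close>

context group
begin

lemma finite_torsion_Int_cyclic:
  assumes x: "x \<in> carrier G"
  shows "finite (torsion_subgroup G \<inter> generate G {x})"
proof (cases "ord x = 0")
  case True
  have "y = \<one>" if y: "y \<in> torsion_subgroup G" "y \<in> generate G {x}" for y
  proof -
    obtain z :: int where z: "y = x [^] z" using y(2) generate_pow[OF x] by blast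
    obtain n :: nat where n: "n > 0" "y [^] n = \<one>" using y(1) unfolding torsion_subgroup_def by blast
    then have "x [^] (z * int n) = \<one>" unfolding z using x by (simp add: int_pow_pow flip: int_pow_int)
    then have "z = 0" using n(1) x True by (simp add: int_pow_eq_id)
    then show ?thesis unfolding z by simp
  qed
  then show ?thesis using finite_subset[of _ "{\<one>}"] by blast
next
  case False
  then have "finite (generate G {x})"
    using x finite_cyclic_subgroup_order[OF x] by (simp add: carrier_subgroup_generated)
  then show ?thesis by simp
qed

end

lemma (in group_hom) hom_torsion_subgroup:
  "x \<in> torsion_subgroup G \<Longrightarrow> h x \<in> torsion_subgroup H"
  unfolding torsion_subgroup_def by (auto simp flip: hom_nat_pow)

context normal
begin

lemma finite_subgroup_if_finite_image:
  assumes N: "subgroup N G" and NH: "finite (N \<inter> H)" and image: "finite ((#>) H ` N)"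
  shows "finite N"
proof (rule ccontr)
  assume "infinite N"
  then obtain x where x: "x \<in> N" and inf: "infinite (r_coset G H -` {H #> x} \<inter> N)"
    using inf_img_fin_domE'[OF image] by (metis imageE)
  interpret N: subgroup N G by fact
  have "r_coset G H -` {H #> x} \<inter> N \<subseteq> (\<lambda>h. x \<otimes> h) ` (N \<inter> H)"
  proof
    fix y assume "y \<in> r_coset G H -` {H #> x} \<inter> N"
    then have y: "y \<in> N" "H #> x = H #> y" by auto
    then have "inv x \<otimes> y \<in> N \<inter> H" using x r_coset_eq_iff by auto
    moreover have "y = x \<otimes> (inv x \<otimes> y)" using x y by simp
    ultimately show "y \<in> (\<lambda>h. x \<otimes> h) ` (N \<inter> H)" by blast
  qed
  then show False using inf NH finite_surj by blast
qed

lemma finite_torsion_Int_cyclic_extension: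
  assumes T: "subgroup (torsion_subgroup G) G" and fin: "finite (torsion_subgroup G \<inter> H)"
    and g: "g \<in> carrier G"
  shows "finite (torsion_subgroup G \<inter> (H <#> generate G {g}))"
proof (rule finite_subgroup_if_finite_image)
  let ?M = "H <#> generate G {g}" and ?Q = "G Mod H"
  show "subgroup (torsion_subgroup G \<inter> ?M) G"
    using g by (intro subgroups_Inter_pair[OF T] mult_norm_subgroup generate_is_subgroup normal_axioms) simp
  show "finite (torsion_subgroup G \<inter> ?M \<inter> H)" using fin by (rule rev_finite_subset) blast
  have "(#>) H ` (torsion_subgroup G \<inter> ?M) \<subseteq> torsion_subgroup ?Q \<inter> generate ?Q {H #> g}"
  proof (intro image_subsetI IntI)
    fix y assume y: "y \<in> torsion_subgroup G \<inter> ?M"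
    then show "H #> y \<in> torsion_subgroup ?Q" by (simp add: quot.hom_torsion_subgroup)
    obtain h c where h: "h \<in> H" and c: "c \<in> generate G {g}" "y = h \<otimes> c"
      using y unfolding set_mult_def by blast
    have "c \<in> carrier G" using c(1) g generate_in_carrier[of "{g}" c] by simp
    then have "H #> y = H #> c" using h c(2) r_coset_eq_one_iff[of h] by simp
    also have "\<dots> \<in> generate ?Q {H #> g}"
      using c(1) g quot.generate_img[of "{g}"] by auto
    finally show "H #> y \<in> generate ?Q {H #> g}" .
  qed
  then show "finite ((#>) H ` (torsion_subgroup G \<inter> ?M))"
    by (rule finite_subset) (use g quot.H.finite_torsion_Int_cyclic in simp)
qed

end

context group
begin

lemma central_cyclic_extension:
  assumes H: "H \<lhd> G" and g: "g \<in> central_modulo G H"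
  shows "H <#> generate G {g} \<lhd> G" and "insert g H \<subseteq> H <#> generate G {g}"
proof -
  interpret H: normal H G by fact
  interpret C: normal "central_modulo G H" G by (rule H.central_modulo_normal)
  have g_carrier: "g \<in> carrier G" using g C.subset by blast
  have gen: "generate G {g} \<subseteq> central_modulo G H"
    using g by (intro generate_subgroup_incl C.subgroup_axioms) simp
  show inc: "insert g H \<subseteq> H <#> generate G {g}"
  proof (intro insert_subsetI subsetI)
    have "\<one> \<otimes> g \<in> H <#> generate G {g}"
      unfolding set_mult_def using H.one_closed generate.incl[of g "{g}" G] by blast
    then show "g \<in> H <#> generate G {g}" using g_carrier by simp
    fix h assume h: "h \<in> H"
    then have "h \<otimes> \<one> \<in> H <#> generate G {g}"
      unfolding set_mult_def using generate.one[of G "{g}"] by blast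
    then show "h \<in> H <#> generate G {g}" using h by simp
  qed
  show "H <#> generate G {g} \<lhd> G"
  proof (rule H.normal_if_central_modulo)
    show "subgroup (H <#> generate G {g}) G"
      using g_carrier by (intro mult_norm_subgroup H generate_is_subgroup) simp
    show "H <#> generate G {g} \<subseteq> central_modulo G H"
      using gen H.subset_central_modulo unfolding set_mult_def by (auto intro!: C.m_closed)
  qed (use inc in blast)
qed

lemma finite_torsion_Int_central_extension:
  assumes T: "subgroup (torsion_subgroup G) G" and "finite X"
    and "H \<lhd> G" "X \<subseteq> central_modulo G H" "finite (torsion_subgroup G \<inter> H)"
  shows "\<exists>H'. H' \<lhd> G \<and> H \<union> X \<subseteq> H' \<and> finite (torsion_subgroup G \<inter> H')"
  using assms(2-)
proof (induction X)
  case (insert x X)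
  then obtain H' where H': "H' \<lhd> G" "H \<union> X \<subseteq> H'" "finite (torsion_subgroup G \<inter> H')" by auto
  have x: "x \<in> central_modulo G H'"
    using insert.prems(2) H'(2) central_modulo_mono[of H H'] by auto
  have "finite (torsion_subgroup G \<inter> (H' <#> generate G {x}))"
    using x central_modulo_closed[of x G H'] H'(1,3)
    by (intro normal.finite_torsion_Int_cyclic_extension T) blast+
  then show ?case using central_cyclic_extension[OF H'(1) x] H'(2)
    by (intro exI[of _ "H' <#> generate G {x}"]) auto
qed auto

lemma lower_central_series_Suc_generators:
  assumes S: "S \<subseteq> carrier G" "generate G S = carrier G"
    and X: "X \<subseteq> lower_central_series G i"
      "lower_central_series G i \<subseteq> generate G (X \<union> lower_central_series G (Suc i))"
  defines "Y \<equiv> (\<lambda>(x, s). commutator G x s) ` (X \<times> S)"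
  shows "Y \<subseteq> lower_central_series G (Suc i)"
    and "lower_central_series G (Suc i) \<subseteq> generate G (Y \<union> lower_central_series G (Suc (Suc i)))"
proof -
  let ?L = "lower_central_series G"
  define M where "M = generate G (Y \<union> ?L (Suc (Suc i)))"
  interpret L: normal "?L (Suc (Suc i))" G by (rule lower_central_series_normal)
  interpret C: normal "central_modulo G (?L (Suc (Suc i)))" G by (rule L.central_modulo_normal)
  show Y: "Y \<subseteq> ?L (Suc i)"
    using X(1) S(1) lower_central_series_subset_central_modulo[of i]
    unfolding Y_def central_modulo_def by auto
  then have gens: "Y \<union> ?L (Suc (Suc i)) \<subseteq> central_modulo G (?L (Suc (Suc i)))"
    using lower_central_series_subset_central_modulo L.subset_central_modulo by blast
  have sub: "subgroup M G"
    unfolding M_def using gens C.subset by (intro generate_is_subgroup) blast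
  have inc: "Y \<union> ?L (Suc (Suc i)) \<subseteq> M" unfolding M_def by (auto intro: generate.incl)
  interpret M: normal M G
    using generate_subgroup_incl[OF gens C.subgroup_axioms] inc unfolding M_def[symmetric]
    by (intro L.normal_if_central_modulo sub) auto
  have "X \<subseteq> central_modulo G M"
  proof
    fix x assume x: "x \<in> X"
    then have "x \<in> carrier G" using X(1) lower_central_series_subset by blast
    then show "x \<in> central_modulo G M"
      using x inc by (intro M.mem_central_modulo_if_generators[OF S]) (auto simp: Y_def)
  qed
  moreover have "?L (Suc i) \<subseteq> central_modulo G M"
    using lower_central_series_subset_central_modulo central_modulo_mono[of "?L (Suc (Suc i))" M] inc
    by blast
  ultimately have "?L i \<subseteq> central_modulo G M"
    using X(2) generate_subgroup_incl[OF _ normal_imp_subgroup[OF M.central_modulo_normal]] by blast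
  then show "?L (Suc i) \<subseteq> M" by (rule lower_central_series_Suc_subset_if_central[OF sub])
qed

lemma lower_central_series_finitely_generated:
  assumes S: "finite S" "S \<subseteq> carrier G" "generate G S = carrier G"
  shows "\<exists>X. finite X \<and> X \<subseteq> lower_central_series G i \<and>
    lower_central_series G i \<subseteq> generate G (X \<union> lower_central_series G (Suc i))"
proof (induction i)
  case 0
  have "generate G S \<subseteq> generate G (S \<union> lower_central_series G (Suc 0))"
    by (intro mono_generate) auto
  then show ?case using S by auto
next
  case (Suc i)
  then obtain X where X: "finite X" "X \<subseteq> lower_central_series G i"
    "lower_central_series G i \<subseteq> generate G (X \<union> lower_central_series G (Suc i))" by blast
  then show ?case
    using lower_central_series_Suc_generators[OF S(2,3) X(2,3)] S(1)
    by (intro exI[of _ "(\<lambda>(x, s). commutator G x s) ` (X \<times> S)"] conjI) simp_all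
qed

lemma finite_torsion_subgroup:
  assumes nil: "nilpotent_group G" and S: "finite S" "S \<subseteq> carrier G" "generate G S = carrier G"
  shows "finite (torsion_subgroup G)"
proof -
  let ?L = "lower_central_series G" and ?T = "torsion_subgroup G"
  have T: "subgroup ?T G" by (rule normal_imp_subgroup[OF torsion_subgroup_normal[OF nil]])
  obtain n where n: "?L n = {\<one>}" using nil unfolding nilpotent_group_def by blast
  have "\<exists>H. H \<lhd> G \<and> ?L (n - i) \<subseteq> H \<and> finite (?T \<inter> H)" if "i \<le> n" for i
    using that
  proof (induction i)
    case 0
    show ?case using n one_is_normal by auto
  next
    case (Suc i)
    define j where "j = n - Suc i"
    have "n - i = Suc j" using Suc.prems unfolding j_def by simp
    then obtain H where H: "H \<lhd> G" "?L (Suc j) \<subseteq> H" "finite (?T \<inter> H)" using Suc by auto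
    obtain X where X: "finite X" "X \<subseteq> ?L j" "?L j \<subseteq> generate G (X \<union> ?L (Suc j))"
      using lower_central_series_finitely_generated[OF S] by blast
    have "X \<subseteq> central_modulo G H"
      using X(2) lower_central_series_subset_central_modulo central_modulo_mono[OF H(2)] by blast
    then obtain H' where H': "H' \<lhd> G" "H \<union> X \<subseteq> H'" "finite (?T \<inter> H')"
      using finite_torsion_Int_central_extension[OF T X(1) H(1) _ H(3)] by blast
    then have "X \<union> ?L (Suc j) \<subseteq> H'" using H(2) by blast
    then have "generate G (X \<union> ?L (Suc j)) \<subseteq> H'"
      by (rule generate_subgroup_incl[OF _ normal_imp_subgroup[OF H'(1)]])
    with X(3) have "?L j \<subseteq> H'" by (rule order_trans)
    then show ?case using H' unfolding j_def by blast
  qed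
  from this[of n] show ?thesis using torsion_subgroup_subset by (auto simp: inf_absorb1 dest: finite_subset)
qed

end

section \<open>A maximum principle\<close>

lemma (in comm_monoid) finprod_nat_pow:
  "f \<in> A \<rightarrow> carrier G \<Longrightarrow> (\<Otimes>i\<in>A. f i [^] (k::nat)) = (\<Otimes>i\<in>A. f i) [^] k"
proof (induction A rule: infinite_finite_induct)
  case (insert x A)
  then have "f x \<in> carrier G" "f \<in> A \<rightarrow> carrier G" by auto
  moreover from this have "(\<lambda>i. f i [^] k) \<in> A \<rightarrow> carrier G" by auto
  ultimately show ?case using insert by (simp add: nat_pow_distrib)
qed simp_all

lemma (in comm_monoid) finprod_eq_finprod_fibers:
  assumes "finite I" "finite F" "F \<subseteq> carrier G" "f \<in> I \<rightarrow> F"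
  shows "(\<Otimes>i\<in>I. f i) = (\<Otimes>w\<in>F. w [^] card {i \<in> I. f i = w})"
proof -
  have "(\<Otimes>i\<in>I. f i) = (\<Otimes>i\<in>(\<Union>w\<in>F. {i \<in> I. f i = w}). f i)"
    using assms by (intro arg_cong[where f = "finprod G f"]) auto
  also have "\<dots> = (\<Otimes>w\<in>F. \<Otimes>i\<in>{i \<in> I. f i = w}. f i)"
    using assms by (intro finprod_UN_disjoint) (auto simp: pairwise_def disjnt_def)
  also have "\<dots> = (\<Otimes>w\<in>F. w [^] card {i \<in> I. f i = w})"
  proof (rule finprod_cong')
    fix w assume "w \<in> F"
    then have "w \<in> carrier G" using assms(3) by blast
    then show "(\<Otimes>i\<in>{i \<in> I. f i = w}. f i) = w [^] card {i \<in> I. f i = w}"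
      by (subst finprod_const[symmetric]) (auto intro!: finprod_cong')
  qed (use assms(3) in auto)
  finally show ?thesis .
qed

context comm_group
begin

definition extreme_point :: "'a set \<Rightarrow> 'a \<Rightarrow> bool" where
  "extreme_point F v \<longleftrightarrow> v \<in> F \<and> (\<forall>m :: 'a \<Rightarrow> nat.
     (\<Otimes>w\<in>F. w [^] m w) = v [^] (\<Sum>w\<in>F. m w) \<longrightarrow> (\<forall>w\<in>F. w \<noteq> v \<longrightarrow> m w = 0))"

lemma extreme_pointD:
  "extreme_point F v \<Longrightarrow> (\<Otimes>w\<in>F. w [^] m w) = v [^] (\<Sum>w\<in>F. m w) \<Longrightarrow> w \<in> F \<Longrightarrow> w \<noteq> v \<Longrightarrow> m w = (0::nat)"
  unfolding extreme_point_def by blast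

lemma finprod_pow_linear:
  assumes "F \<subseteq> carrier G"
  shows "(\<Otimes>w\<in>F. w [^] (a * l w + b * m w :: nat)) =
    (\<Otimes>w\<in>F. w [^] l w) [^] a \<otimes> (\<Otimes>w\<in>F. w [^] m w) [^] b"
proof -
  have "(\<Otimes>w\<in>F. w [^] (a * l w + b * m w)) = (\<Otimes>w\<in>F. (w [^] l w) [^] a \<otimes> (w [^] m w) [^] b)"
    using assms by (intro finprod_cong') (auto simp: nat_pow_pow nat_pow_mult mult.commute)
  also have "\<dots> = (\<Otimes>w\<in>F. (w [^] l w) [^] a) \<otimes> (\<Otimes>w\<in>F. (w [^] m w) [^] b)"
    using assms by (intro finprod_multf) auto
  also have "\<dots> = (\<Otimes>w\<in>F. w [^] l w) [^] a \<otimes> (\<Otimes>w\<in>F. w [^] m w) [^] b"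
    using assms by (subst (1 2) finprod_nat_pow) auto
  finally show ?thesis .
qed

text \<open>If \<open>v\<close> is extreme in \<open>F\<close> but lies between \<open>u\<close> and other points of \<open>F\<close>, then substituting a
  convex combination for \<open>u\<close> expresses \<open>v\<close> by points of \<open>F\<close>.\<close>

lemma extreme_point_insert:
  assumes tf: "torsion_free G" and F: "finite F" "F \<subseteq> carrier G" and u: "u \<in> carrier G" "u \<notin> F"
    and v: "extreme_point F v"
    and m: "u [^] m u \<otimes> (\<Otimes>w\<in>F. w [^] m w) = v [^] (m u + (\<Sum>w\<in>F. m w))" "m u > (0::nat)"
  shows "extreme_point (insert u F) u"
proof -
  have vF: "v \<in> F" "v \<in> carrier G" using v F(2) unfolding extreme_point_def by auto
  have products_closed: "(\<Otimes>w\<in>F. w [^] l w) \<in> carrier G" for l :: "'a \<Rightarrow> nat"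
    using F(2) by (intro finprod_closed) auto
  have "l w = 0"
    if "(\<Otimes>w\<in>insert u F. w [^] l w) = u [^] (\<Sum>w\<in>insert u F. l w)" and w: "w \<in> F"
    for l :: "'a \<Rightarrow> nat" and w
  proof -
    define L where "L = (\<Sum>w\<in>F. l w)"
    have "(\<Otimes>w\<in>insert u F. w [^] l w) = u [^] l u \<otimes> (\<Otimes>w\<in>F. w [^] l w)"
      using F u by (intro finprod_insert) auto
    then have lu: "(\<Otimes>w\<in>F. w [^] l w) = u [^] L"
      using that(1) F u products_closed by (simp add: L_def flip: nat_pow_mult)
    have "(\<Otimes>w\<in>F. w [^] (m u * l w + L * m w)) = (u [^] m u \<otimes> (\<Otimes>w\<in>F. w [^] m w)) [^] L"
      unfolding finprod_pow_linear[OF F(2)] lu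
      using u products_closed by (simp add: nat_pow_distrib nat_pow_pow mult.commute)
    also have "\<dots> = v [^] (\<Sum>w\<in>F. m u * l w + L * m w)"
      unfolding m(1) sum.distrib sum_distrib_left[symmetric] L_def[symmetric]
      using vF by (simp add: nat_pow_pow algebra_simps)
    finally have l0: "l w = 0" if "w \<in> F" "w \<noteq> v" for w
      using extreme_pointD[OF v _ that] m(2) by fastforce
    then have "(\<Otimes>w\<in>F. w [^] l w) = (\<Otimes>w\<in>F. if v = w then w [^] l w else \<one>)"
      using F(2) by (intro finprod_cong') auto
    then have "u [^] L = v [^] l v" using F vF lu by (subst (asm) finprod_singleton) auto
    moreover have "L = l v"
      using l0 F(1) vF unfolding L_def by (simp add: sum.remove[of F v])
    ultimately have "l v = 0"
      using torsion_free_pow_inject[OF tf, of u v "l v"] u vF m_comm by auto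
    then show ?thesis using l0 w by blast
  qed
  then show ?thesis unfolding extreme_point_def by blast
qed

lemma exists_extreme_point:
  assumes tf: "torsion_free G" and "finite F" "F \<noteq> {}" "F \<subseteq> carrier G"
  shows "\<exists>v. extreme_point F v"
  using assms(2-)
proof (induction rule: finite_ne_induct)
  case (singleton v)
  then show ?case by (auto simp: extreme_point_def)
next
  case (insert u F)
  then obtain v where v: "extreme_point F v" by auto
  have F: "F \<subseteq> carrier G" and u: "u \<in> carrier G" using insert.prems by auto
  show ?case
  proof (cases "extreme_point (insert u F) v")
    case False
    then obtain m :: "'a \<Rightarrow> nat" and w where
      m: "(\<Otimes>w\<in>insert u F. w [^] m w) = v [^] (\<Sum>w\<in>insert u F. m w)"
      and w: "w \<in> insert u F" "w \<noteq> v" "m w \<noteq> 0"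
      using v unfolding extreme_point_def by blast
    have ins: "u [^] m u \<otimes> (\<Otimes>w\<in>F. w [^] m w) = v [^] (m u + (\<Sum>w\<in>F. m w))"
      using m insert.hyps F u by (subst (asm) finprod_insert) auto
    have "m u > 0"
    proof (rule ccontr)
      assume mu: "\<not> m u > 0"
      then have "(\<Otimes>w\<in>F. w [^] m w) = v [^] (\<Sum>w\<in>F. m w)"
        using ins F by (simp add: Pi_iff subset_iff)
      then show False using extreme_pointD[OF v, of m w] w mu by auto
    qed
    with ins have "extreme_point (insert u F) u"
      using insert.hyps by (intro extreme_point_insert[OF tf _ F u _ v]) auto
    then show ?thesis by blast
  qed blast
qed

lemma eq_extreme_point_if_finprod:
  assumes v: "extreme_point F v" and F: "finite F" "F \<subseteq> carrier G"
    and I: "finite I" and f: "f \<in> I \<rightarrow> F" and eq: "(\<Otimes>i\<in>I. f i) = v [^] card I" and i: "i \<in> I"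
  shows "f i = v"
proof (rule ccontr)
  assume neq: "f i \<noteq> v"
  have "(\<Sum>w\<in>F. card {i \<in> I. f i = w}) = card I"
    using sum.group[OF I F(1), of f "\<lambda>_. 1::nat"] f by (simp add: image_subset_iff_funcset)
  then have "card {j \<in> I. f j = f i} = 0"
    using extreme_pointD[OF v _ _ neq, of "\<lambda>w. card {j \<in> I. f j = w}"]
      eq finprod_eq_finprod_fibers[OF I F f] f i by auto
  then show False using I i by auto
qed

end

context group
begin

lemma symmetric_generating_induct:
  assumes S: "symmetric_finite_generating_set G S" and g: "g \<in> carrier G"
    and one: "P \<one>" and step: "\<And>h s. h \<in> carrier G \<Longrightarrow> s \<in> S \<Longrightarrow> P h \<Longrightarrow> P (h \<otimes> s)"
  shows "P g"
proof -
  have SG: "S \<subseteq> carrier G" and inv: "set_inv S = S" and "generate G S = carrier G"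
    using S unfolding symmetric_finite_generating_set_def by auto
  then have "g \<in> generate G S" using g by simp
  then have "\<forall>h\<in>carrier G. P h \<longrightarrow> P (h \<otimes> g)"
  proof induction
    case (inv s)
    then have "inv s \<in> S" using \<open>set_inv S = S\<close> unfolding SET_INV_def by blast
    then show ?case using step by blast
  next
    case (eng a b)
    then have "a \<in> carrier G" "b \<in> carrier G" using generate_in_carrier[OF SG] by auto
    with eng.IH show ?case by (simp flip: m_assoc)
  qed (auto simp: step)
  then show ?thesis using one g by force
qed

lemma harmonic_imp_constant:
  assumes S: "symmetric_finite_generating_set G S" and A: "comm_group A" "torsion_free A"
    and d: "d \<in> carrier G \<rightarrow> carrier A" and fin: "finite (d ` carrier G)"
    and harmonic: "\<And>x. x \<in> carrier G \<Longrightarrow> finprod A (\<lambda>s. d (x \<otimes> s)) S = d x [^]\<^bsub>A\<^esub> card S"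
    and x: "x \<in> carrier G"
  shows "d x = d \<one>"
proof -
  interpret A: comm_group A by (rule A(1))
  have finS: "finite S" and SG: "S \<subseteq> carrier G"
    using S unfolding symmetric_finite_generating_set_def by auto
  have dA: "d ` carrier G \<subseteq> carrier A" using d by blast
  then obtain v where v: "A.extreme_point (d ` carrier G) v"
    using A.exists_extreme_point[OF A(2) fin] by blast
  then obtain y where y: "y \<in> carrier G" "d y = v" unfolding A.extreme_point_def by blast
  have from_y: "d (y \<otimes> g) = v" if "g \<in> carrier G" for g
    using S that
  proof (rule symmetric_generating_induct)
    fix h s assume h: "h \<in> carrier G" and s: "s \<in> S" and IH: "d (y \<otimes> h) = v"
    have "d (y \<otimes> h \<otimes> s) = v"
      using harmonic[of "y \<otimes> h"] IH y(1) h SG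
      by (intro A.eq_extreme_point_if_finprod[OF v fin dA finS _ _ s]) auto
    then show "d (y \<otimes> (h \<otimes> s)) = v" using y(1) h s SG by (simp add: m_assoc subset_iff)
  qed (use y in simp)
  have "d z = v" if "z \<in> carrier G" for z
    using from_y[of "inv y \<otimes> z"] that y(1) by simp
  then show ?thesis using x by simp
qed

end

section \<open>Cayley graphs\<close>

lemma graph_isomorphism_inv_into:
  assumes "graph_isomorphism X Y f"
  shows "graph_isomorphism Y X (inv_into (pverts X) f)"
proof -
  have bij: "bij_betw f (pverts X) (pverts Y)" using assms unfolding graph_isomorphism_def by blast
  have arcs: "(u, v) \<in> parcs X \<longleftrightarrow> (f u, f v) \<in> parcs Y" if "u \<in> pverts X" "v \<in> pverts X" for u v
    using assms that unfolding graph_isomorphism_def by blast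
  let ?g = "inv_into (pverts X) f"
  have inv: "?g v \<in> pverts X" "f (?g v) = v" if "v \<in> pverts Y" for v
    using bij_betw_apply[OF bij_betw_inv_into[OF bij] that] bij_betw_inv_into_right[OF bij that] by auto
  then show ?thesis
    unfolding graph_isomorphism_def using bij_betw_inv_into[OF bij] arcs by simp
qed

lemma graph_isomorphism_comp:
  assumes "graph_isomorphism X Y f" "graph_isomorphism Y Z g"
  shows "graph_isomorphism X Z (g \<circ> f)"
proof -
  have "bij_betw f (pverts X) (pverts Y)" using assms(1) unfolding graph_isomorphism_def by blast
  then have "f u \<in> pverts Y" if "u \<in> pverts X" for u using that by (rule bij_betw_apply)
  then show ?thesis
    using assms unfolding graph_isomorphism_def by (auto intro: bij_betw_trans)
qed

lemma pverts_Cay [simp]: "pverts (Cay G S) = carrier G"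
  by (simp add: Cay_def)

context group
begin

lemma parcs_Cay_iff:
  assumes "S \<subseteq> carrier G" "u \<in> carrier G" "v \<in> carrier G"
  shows "(u, v) \<in> parcs (Cay G S) \<longleftrightarrow> inv u \<otimes> v \<in> S"
proof -
  have "v = u \<otimes> s \<longleftrightarrow> inv u \<otimes> v = s" if "s \<in> S" for s
    using that assms inv_solve_left'[of s u v] by blast
  then have "(\<exists>s\<in>S. v = u \<otimes> s) \<longleftrightarrow> inv u \<otimes> v \<in> S" by auto
  then show ?thesis unfolding Cay_def using assms(2) by auto
qed

lemma
  assumes "S \<subseteq> carrier G" "x \<in> carrier G"
  shows bij_betw_mult_neighbours: "bij_betw (\<lambda>s. x \<otimes> s) S {v \<in> carrier G. inv x \<otimes> v \<in> S}"
    and bij_betw_inv_mult_neighbours: "bij_betw (\<lambda>v. inv x \<otimes> v) {v \<in> carrier G. inv x \<otimes> v \<in> S} S"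
proof -
  have closed: "s \<in> carrier G" if "s \<in> S" for s using that assms(1) by blast
  show "bij_betw (\<lambda>s. x \<otimes> s) S {v \<in> carrier G. inv x \<otimes> v \<in> S}"
    by (rule bij_betw_byWitness[where f' = "\<lambda>v. inv x \<otimes> v"]) (use assms closed in auto)
  show "bij_betw (\<lambda>v. inv x \<otimes> v) {v \<in> carrier G. inv x \<otimes> v \<in> S} S"
    by (rule bij_betw_byWitness[where f' = "\<lambda>s. x \<otimes> s"]) (use assms closed in auto)
qed

lemma graph_isomorphism_left_translation:
  assumes S: "S \<subseteq> carrier G" and g: "g \<in> carrier G"
  shows "graph_isomorphism (Cay G S) (Cay G S) (\<lambda>x. g \<otimes> x)"
proof -
  have "bij_betw (\<lambda>x. g \<otimes> x) (carrier G) (carrier G)"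
    using g by (simp add: bij_betw_def inj_on_cmult surj_const_mult)
  moreover have "inv (g \<otimes> u) \<otimes> (g \<otimes> v) = inv u \<otimes> v" if "u \<in> carrier G" "v \<in> carrier G" for u v
    using g that by (simp add: inv_mult_group m_assoc)
  ultimately show ?thesis
    unfolding graph_isomorphism_def using g by (simp add: parcs_Cay_iff[OF S])
qed

end

lemma graph_isomorphism_Cay_bij_betw:
  assumes G: "group G" "S \<subseteq> carrier G" and H: "group H" "T \<subseteq> carrier H"
    and iso: "graph_isomorphism (Cay G S) (Cay H T) f" and x: "x \<in> carrier G"
  shows "bij_betw (\<lambda>s. inv\<^bsub>H\<^esub> f x \<otimes>\<^bsub>H\<^esub> f (x \<otimes>\<^bsub>G\<^esub> s)) S T"
proof -
  interpret G: group G by (rule G)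
  interpret H: group H by (rule H)
  have bij: "bij_betw f (carrier G) (carrier H)" using iso unfolding graph_isomorphism_def by simp
  have f: "f u \<in> carrier H" if "u \<in> carrier G" for u using bij that by (rule bij_betw_apply)
  have "inv\<^bsub>H\<^esub> f x \<otimes>\<^bsub>H\<^esub> f v \<in> T \<longleftrightarrow> inv\<^bsub>G\<^esub> x \<otimes>\<^bsub>G\<^esub> v \<in> S" if "v \<in> carrier G" for v
    using iso x that f G.parcs_Cay_iff[OF G(2) x that] H.parcs_Cay_iff[OF H(2), of "f x" "f v"]
    unfolding graph_isomorphism_def by simp
  then have "bij_betw f {v \<in> carrier G. inv\<^bsub>G\<^esub> x \<otimes>\<^bsub>G\<^esub> v \<in> S} {w \<in> carrier H. inv\<^bsub>H\<^esub> f x \<otimes>\<^bsub>H\<^esub> w \<in> T}"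
    by (rule bij_betw_Collect[OF bij])
  then have "bij_betw ((\<lambda>w. inv\<^bsub>H\<^esub> f x \<otimes>\<^bsub>H\<^esub> w) \<circ> (f \<circ> (\<lambda>s. x \<otimes>\<^bsub>G\<^esub> s))) S T"
    using G.bij_betw_mult_neighbours[OF G(2) x] H.bij_betw_inv_mult_neighbours[OF H(2) f[OF x]]
    by (blast intro: bij_betw_trans)
  then show ?thesis by (simp add: comp_def)
qed

section \<open>Central displacements\<close>

lemma (in comm_group) finprod_eq_one_if_antisymmetric:
  assumes tf: "torsion_free G" and \<iota>: "bij_betw \<iota> S S" and f: "f \<in> S \<rightarrow> carrier G"
    and anti: "\<And>s. s \<in> S \<Longrightarrow> f (\<iota> s) = inv (f s)"
  shows "finprod G f S = \<one>"
proof -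
  have fs: "f s \<in> carrier G" "f (\<iota> s) \<in> carrier G" if "s \<in> S" for s
    using that f bij_betw_apply[OF \<iota>] by auto
  have "finprod G f S = finprod G (\<lambda>s. f (\<iota> s)) S"
    using finprod_reindex[of f \<iota> S] f \<iota> by (simp add: bij_betw_def)
  then have "finprod G f S \<otimes> finprod G f S = finprod G (\<lambda>s. f s \<otimes> f (\<iota> s)) S"
    using f fs by (subst finprod_multf) auto
  also have "\<dots> = \<one>" using anti fs by (intro finprod_one_eqI) simp
  finally have "finprod G f S [^] (2::nat) = \<one>" using f by (simp add: numeral_2_eq_2)
  then show ?thesis by (rule torsion_freeD[OF tf finprod_closed[OF f] zero_less_numeral])
qed

lemma (in comm_group) finprod_eq_pow_card:
  assumes d: "d \<in> S \<rightarrow> carrier G" and z: "z \<in> carrier G"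
    and one: "finprod G (\<lambda>s. d s \<otimes> inv z) S = \<one>"
  shows "finprod G d S = z [^] card S"
proof -
  have "finprod G d S = finprod G (\<lambda>s. (d s \<otimes> inv z) \<otimes> z) S"
    using d z by (intro finprod_cong') (auto simp: m_assoc Pi_iff)
  also have "\<dots> = finprod G (\<lambda>s. d s \<otimes> inv z) S \<otimes> finprod G (\<lambda>_. z) S"
    using d z by (intro finprod_multf) auto
  also have "\<dots> = z [^] card S" using z by (simp add: one finprod_const)
  finally show ?thesis .
qed

context group
begin

lemma exists_equivariant_map_to_subgroup:
  assumes D: "subgroup D G"
  obtains u where "\<And>q. q \<in> carrier G \<Longrightarrow> u q \<in> D"
    and "\<And>d q. d \<in> D \<Longrightarrow> q \<in> carrier G \<Longrightarrow> u (d \<otimes> q) = d \<otimes> u q"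
proof
  interpret D: subgroup D G by (rule D)
  define r where "r X = (SOME y. y \<in> X)" for X :: "'a set"
  have r: "r (D #> q) \<in> D #> q" if "q \<in> carrier G" for q
    unfolding r_def using rcos_self[OF that D] by (rule someI)
  then have r_closed: "r (D #> q) \<in> carrier G" if "q \<in> carrier G" for q
    using that D.elemrcos_carrier by blast
  show "q \<otimes> inv (r (D #> q)) \<in> D" if q: "q \<in> carrier G" for q
  proof (rule D.rcos_module_imp[OF is_group r_closed[OF q]])
    show "q \<in> D #> r (D #> q)"
      using rcos_self[OF q D] repr_independence[OF r[OF q] q D] by simp
  qed
  show "d \<otimes> q \<otimes> inv (r (D #> (d \<otimes> q))) = d \<otimes> (q \<otimes> inv (r (D #> q)))"
    if d: "d \<in> D" and q: "q \<in> carrier G" for d q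
  proof -
    have "D #> (d \<otimes> q) = D #> d #> q" using d q D.subset by (simp add: coset_mult_assoc)
    also have "D #> d = D" using is_group d by (rule D.rcos_const)
    finally show ?thesis using d q r_closed[OF q] by (simp add: m_assoc)
  qed
qed

text \<open>Composing \<open>p\<close> with an equivariant map to the centre turns the shifts into factors.\<close>

lemma finprod_central_shift_eq_one:
  assumes a: "bij_betw a I C" and b: "bij_betw b I C" and p: "p \<in> C \<rightarrow> carrier G"
    and \<delta>: "\<delta> \<in> I \<rightarrow> center G" and shift: "\<And>i. i \<in> I \<Longrightarrow> p (b i) = \<delta> i \<otimes> p (a i)"
  shows "finprod (center_group G) \<delta> I = \<one>"
proof -
  interpret A: comm_group "center_group G" by (rule center_comm_group)
  interpret Z: normal "center G" G by (rule center_normal)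
  obtain u where u: "\<And>q. q \<in> carrier G \<Longrightarrow> u q \<in> center G"
    and u_shift: "\<And>z q. z \<in> center G \<Longrightarrow> q \<in> carrier G \<Longrightarrow> u (z \<otimes> q) = z \<otimes> u q"
    using exists_equivariant_map_to_subgroup[OF Z.subgroup_axioms] by blast
  have pa: "p (a i) \<in> carrier G" and pb: "p (b i) \<in> carrier G" if "i \<in> I" for i
    using p bij_betw_apply[OF a that] bij_betw_apply[OF b that] by auto
  let ?U = "finprod (center_group G) (\<lambda>c. u (p c)) C"
  have up: "(\<lambda>c. u (p c)) \<in> C \<rightarrow> carrier (center_group G)" using p u by auto
  then have U: "?U \<in> carrier (center_group G)" by (rule A.finprod_closed)
  have reindex: "finprod (center_group G) (\<lambda>i. u (p (h i))) I = ?U" if "bij_betw h I C" for h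
    using A.finprod_reindex[of "\<lambda>c. u (p c)" h I] that up by (simp add: bij_betw_def)
  have "?U = finprod (center_group G) (\<lambda>i. \<delta> i \<otimes>\<^bsub>center_group G\<^esub> u (p (a i))) I"
    unfolding reindex[OF b, symmetric]
    using shift u_shift \<delta> pa pb u by (intro A.finprod_cong') (auto simp: Pi_iff)
  also have "\<dots> = finprod (center_group G) \<delta> I \<otimes>\<^bsub>center_group G\<^esub> ?U"
    unfolding reindex[OF a, symmetric] using \<delta> u pa by (intro A.finprod_multf) auto
  finally show ?thesis
    using U A.finprod_closed[of \<delta> I] \<delta> A.r_cancel_one'[of ?U "finprod (center_group G) \<delta> I"] by simp
qed

lemma central_shift_eq_one:
  assumes tf: "torsion_free G" and I: "finite I" "I \<noteq> {}"
    and a: "bij_betw a I C" and b: "bij_betw b I C" and p: "p \<in> C \<rightarrow> carrier G"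
    and z: "z \<in> center G" and shift: "\<And>i. i \<in> I \<Longrightarrow> p (b i) = z \<otimes> p (a i)"
  shows "z = \<one>"
proof -
  interpret A: comm_group "center_group G" by (rule center_comm_group)
  have "z [^]\<^bsub>center_group G\<^esub> card I = \<one>"
    using finprod_central_shift_eq_one[OF a b p _ shift] z A.finprod_const[of z I] by simp
  then have "z [^] card I = \<one>" by (simp flip: nat_pow_consistent)
  moreover have "z \<in> carrier G" "card I > 0" using z center_subset I by (auto simp: card_gt_0_iff)
  ultimately show ?thesis using torsion_freeD[OF tf] by blast
qed

lemma finprod_commutator_eq_one:
  assumes tf: "torsion_free G" and \<iota>: "bij_betw \<iota> S S"
    and q: "q \<in> S \<rightarrow> carrier G" and q_inv: "\<And>s. s \<in> S \<Longrightarrow> q (\<iota> s) = inv (q s)"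
    and e: "e \<in> carrier G" and comm: "\<And>g. g \<in> carrier G \<Longrightarrow> commutator G g e \<in> center G"
  shows "finprod (center_group G) (\<lambda>s. commutator G (q s) e) S = \<one>"
proof -
  let ?A = "center_group G"
  interpret A: comm_group ?A by (rule center_comm_group)
  interpret Z: normal "center G" G by (rule center_normal)
  have "finprod ?A (\<lambda>s. commutator G (q s) e) S = \<one>\<^bsub>?A\<^esub>"
  proof (rule A.finprod_eq_one_if_antisymmetric[OF torsion_free_subgroup[OF tf Z.subgroup_axioms] \<iota>])
    show "(\<lambda>s. commutator G (q s) e) \<in> S \<rightarrow> carrier ?A" using q comm by auto
    fix s assume "s \<in> S"
    then have "q s \<in> carrier G" "q (\<iota> s) = inv (q s)" using q q_inv by auto
    then show "commutator G (q (\<iota> s)) e = inv\<^bsub>?A\<^esub> commutator G (q s) e"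
      using e comm m_inv_consistent[OF Z.subgroup_axioms] by (simp add: commutator_inv_left_if_center)
  qed
  then show ?thesis by simp
qed

lemma conj_eq_mult_commutator:
  "e \<in> carrier G \<Longrightarrow> q \<in> carrier G \<Longrightarrow> inv e \<otimes> q \<otimes> e = q \<otimes> commutator G (inv q) (inv e)"
  by (simp add: commutator_def m_assoc)

lemma center_mult_left_commute:
  assumes "z \<in> center G" "w \<in> center G" "x \<in> carrier G"
  shows "z \<otimes> (x \<otimes> w) = w \<otimes> z \<otimes> x"
proof -
  have in_carrier: "z \<in> carrier G" "w \<in> carrier G" using assms center_subset by auto
  have "z \<otimes> (x \<otimes> w) = z \<otimes> w \<otimes> x"
    using in_carrier assms(3) center_commute[OF assms(2,3)] by (simp add: m_assoc)
  also have "z \<otimes> w = w \<otimes> z" using assms(1) in_carrier(2) by (rule center_commute)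
  finally show ?thesis .
qed

text \<open>Modulo the centre \<open>q\<close> is equivariant under conjugation by \<open>e\<close>; the commutators by which it
  fails to be equivariant cancel in pairs because \<open>S\<close> is symmetric.\<close>

lemma finprod_central_displacement:
  assumes tf: "torsion_free G" and \<iota>: "bij_betw \<iota> S S" and \<sigma>: "bij_betw \<sigma> S S"
    and q: "q \<in> S \<rightarrow> carrier G" and q_inv: "\<And>s. s \<in> S \<Longrightarrow> q (\<iota> s) = inv (q s)"
    and e: "e \<in> central_modulo G (center G)" and z: "z \<in> center G" and d: "d \<in> S \<rightarrow> center G"
    and perm: "\<And>s. s \<in> S \<Longrightarrow> q (\<sigma> s) = inv z \<otimes> (inv e \<otimes> q s \<otimes> e) \<otimes> d s"
  shows "finprod (center_group G) d S = z [^]\<^bsub>center_group G\<^esub> card S"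
proof -
  let ?A = "center_group G"
  interpret A: comm_group ?A by (rule center_comm_group)
  interpret Z: normal "center G" G by (rule center_normal)
  interpret Z2: normal "central_modulo G (center G)" G by (rule Z.central_modulo_normal)
  have e_carrier: "e \<in> carrier G" using e by simp
  have q_carrier: "q s \<in> carrier G" if "s \<in> S" for s using that q by auto
  define \<chi> where "\<chi> s = commutator G (inv (q s)) (inv e)" for s
  have comm: "commutator G g (inv e) \<in> center G" if "g \<in> carrier G" for g
    using Z2.m_inv_closed[OF e] that e_carrier commutator_mem_sym[OF Z.subgroup_axioms, of "inv e" g]
    unfolding central_modulo_def by auto
  then have \<chi>: "\<chi> \<in> S \<rightarrow> center G" unfolding \<chi>_def using q_carrier by auto
  have dz: "(\<lambda>s. d s \<otimes> inv z) \<in> S \<rightarrow> center G" using d z by auto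
  have "finprod ?A (\<lambda>s. \<chi> s \<otimes> (d s \<otimes> inv z)) S = \<one>"
  proof (rule finprod_central_shift_eq_one[OF bij_betw_id \<sigma> q])
    fix s assume s: "s \<in> S"
    have in_center: "\<chi> s \<in> center G" "d s \<in> center G" "inv z \<in> center G" using s \<chi> d z by auto
    have "q (\<sigma> s) = inv z \<otimes> (q s \<otimes> (\<chi> s \<otimes> d s))"
      unfolding perm[OF s] conj_eq_mult_commutator[OF e_carrier q_carrier[OF s]] \<chi>_def[symmetric]
      using in_center q_carrier[OF s] by (simp add: m_assoc)
    also have "\<dots> = \<chi> s \<otimes> d s \<otimes> inv z \<otimes> q s"
      using in_center q_carrier[OF s] by (intro center_mult_left_commute) auto
    finally show "q (\<sigma> s) = \<chi> s \<otimes> (d s \<otimes> inv z) \<otimes> q (id s)" using in_center by (simp add: m_assoc)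
  qed (use \<chi> dz in auto)
  moreover have "finprod ?A \<chi> S = \<one>"
    unfolding \<chi>_def using q_carrier q_inv e_carrier comm by (intro finprod_commutator_eq_one[OF tf \<iota>]) auto
  ultimately have "finprod ?A (\<lambda>s. d s \<otimes> inv z) S = \<one>"
    using A.finprod_multf[of \<chi> S "\<lambda>s. d s \<otimes> inv z"] A.finprod_closed[of "\<lambda>s. d s \<otimes> inv z" S] \<chi> dz
      center_subset by auto
  then show ?thesis
    using d z m_inv_consistent[OF Z.subgroup_axioms] by (intro A.finprod_eq_pow_card) simp_all
qed

lemma pow_commutes_if_finite_conjugates:
  assumes e: "e \<in> carrier G" and t: "t \<in> carrier G"
    and fin: "finite (range (\<lambda>m::nat. inv (e [^] m) \<otimes> t \<otimes> e [^] m))"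
  shows "\<exists>k > 0. e [^] (k::nat) \<otimes> t = t \<otimes> e [^] k"
proof -
  let ?conj = "\<lambda>m::nat. inv (e [^] m) \<otimes> t \<otimes> e [^] m"
  have "\<not> inj ?conj" using fin finite_imageD infinite_UNIV_nat by blast
  then obtain m n where "m < n" and mn: "?conj m = ?conj n" unfolding inj_def by (metis nat_neq_iff)
  then obtain k where k: "k > 0" "n = k + m" by (metis less_imp_add_positive add.commute)
  have "inv (e [^] m) \<otimes> t \<otimes> e [^] m = inv (e [^] m) \<otimes> ?conj k \<otimes> e [^] m"
    unfolding mn k(2) using e t by (simp add: m_assoc inv_mult_group flip: nat_pow_mult)
  then have "t = ?conj k" using e t by simp
  then have "e [^] k \<otimes> t = e [^] k \<otimes> ?conj k" by simp
  also have "\<dots> = t \<otimes> e [^] k" using e t by (simp add: m_assoc)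
  finally show ?thesis using k(1) by blast
qed

lemma pow_mem_center_if_conj_permutes:
  assumes T: "finite T" "T \<subseteq> carrier G" "generate G T = carrier G" and e: "e \<in> carrier G"
    and conj: "\<And>t. t \<in> T \<Longrightarrow> inv e \<otimes> t \<otimes> e \<in> T"
  shows "\<exists>k > 0. e [^] (k::nat) \<in> center G"
proof -
  have conj_pow: "inv (e [^] m) \<otimes> t \<otimes> e [^] m \<in> T" if t: "t \<in> T" for t and m :: nat
  proof (induction m)
    case (Suc m)
    have "inv (e [^] Suc m) \<otimes> t \<otimes> e [^] Suc m = inv e \<otimes> (inv (e [^] m) \<otimes> t \<otimes> e [^] m) \<otimes> e"
      using t T(2) e by (simp add: m_assoc inv_mult_group subset_iff)
    then show ?case using conj[OF Suc] by simp
  qed (use t T(2) in auto)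
  have "\<exists>k > 0. e [^] (k::nat) \<otimes> t = t \<otimes> e [^] k" if t: "t \<in> T" for t
  proof (rule pow_commutes_if_finite_conjugates[OF e])
    show "t \<in> carrier G" using t T(2) by blast
    show "finite (range (\<lambda>m::nat. inv (e [^] m) \<otimes> t \<otimes> e [^] m))"
      by (rule finite_subset[OF _ T(1)]) (use conj_pow[OF t] in auto)
  qed
  then obtain k :: "'a \<Rightarrow> nat"
    where k: "\<And>t. t \<in> T \<Longrightarrow> k t > 0" "\<And>t. t \<in> T \<Longrightarrow> e [^] k t \<otimes> t = t \<otimes> e [^] k t" by metis
  define K where "K = (\<Prod>t\<in>T. k t)"
  have "e [^] K \<otimes> t = t \<otimes> e [^] K" if t: "t \<in> T" for t
  proof -
    have "k t dvd K" unfolding K_def using T(1) t by (rule dvd_prodI)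
    then obtain l where "K = k t * l" by blast
    then show ?thesis
      using group_commutes_pow[OF k(2)[OF t], of l] e t T(2) by (auto simp: nat_pow_pow)
  qed
  then have "e [^] K \<in> center G"
    using e T(3) centralizer_generate[OF T(2)] unfolding centralizer_def by auto
  moreover have "K > 0" unfolding K_def using k(1) by (simp add: prod_pos)
  ultimately show ?thesis by blast
qed

end

section \<open>Automorphisms of bounded displacement\<close>

lemma (in normal) r_coset_mem_central_modulo_center:
  assumes "g \<in> central_modulo G (central_modulo G H)"
  shows "H #> g \<in> central_modulo (G Mod H) (center (G Mod H))"
proof -
  have g: "g \<in> carrier G" using assms by (rule central_modulo_closed)
  have "commutator (G Mod H) (H #> g) (H #> x) \<in> center (G Mod H)" if x: "x \<in> carrier G" for x
  proof -
    have "commutator G g x \<in> central_modulo G H" using assms x unfolding central_modulo_def by blast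
    then show ?thesis
      using g x unfolding central_modulo_eq_vimage_center by (simp add: quot.hom_commutator)
  qed
  then show ?thesis using g unfolding central_modulo_def by (auto simp: carrier_FactGroup)
qed

locale fg_nilpotent_group = group G for G :: "('a, 'b) monoid_scheme" (structure) +
  fixes S :: "'a set"
  assumes nilpotent: "nilpotent_group G"
    and generators: "symmetric_finite_generating_set G S"
begin

lemma finite_S: "finite S" and S_subset: "S \<subseteq> carrier G" and generate_S: "generate G S = carrier G"
  using generators unfolding symmetric_finite_generating_set_def by auto

lemma S_closed [simp]: "s \<in> S \<Longrightarrow> s \<in> carrier G"
  using S_subset by blast

lemma bij_betw_inv_S: "bij_betw (m_inv G) S S"
proof (rule bij_betw_byWitness)
  show "m_inv G ` S \<subseteq> S" "m_inv G ` S \<subseteq> S"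
    using generators unfolding symmetric_finite_generating_set_def SET_INV_def by auto
qed auto

abbreviation Z :: "nat \<Rightarrow> 'a set" where
  "Z \<equiv> upper_central_series G (torsion_subgroup G)"

lemma Z_normal: "Z i \<lhd> G"
  by (intro upper_central_series_normal torsion_subgroup_normal nilpotent)

sublocale Z: normal "Z i" G for i
  by (rule Z_normal)

lemma torsion_free_Mod_Z: "torsion_free (G Mod Z i)"
  using nilpotent torsion_subgroup_normal
  by (intro torsion_free_Mod_upper_central_series torsion_free_Mod_torsion) auto

lemma Z_mono: "i \<le> j \<Longrightarrow> Z i \<subseteq> Z j"
  by (intro upper_central_series_mono torsion_subgroup_normal nilpotent)

lemma Z_eq_carrier: "\<exists>n\<ge>i. Z n = carrier G"
proof -
  obtain n where "Z n = carrier G"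
    using nilpotent_upper_central_series[OF nilpotent torsion_subgroup_normal[OF nilpotent]] by blast
  then have "Z (max i n) = carrier G" using Z_mono[of n "max i n"] Z.subset by auto
  then show ?thesis using max.cobounded1 by blast
qed

lemma finite_Z_0: "finite (Z 0)"
  using finite_torsion_subgroup[OF nilpotent finite_S S_subset generate_S]
  by (simp add: upper_central_series.simps)

lemma mem_Z_Suc_iff: "g \<in> Z (Suc i) \<longleftrightarrow> g \<in> carrier G \<and> Z i #> g \<in> center (G Mod Z i)"
  unfolding upper_central_series.simps Z.central_modulo_eq_vimage_center by blast

lemma Z_coset_commute: "g \<in> Z (Suc i) \<Longrightarrow> x \<in> carrier G \<Longrightarrow> Z i #> (g \<otimes> x) = Z i #> (x \<otimes> g)"
  using Z.quot.H.center_commute[of "Z i #> g" i "Z i #> x"] by (simp add: mem_Z_Suc_iff)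

lemma mem_Z_if_pow_mem:
  "x \<in> carrier G \<Longrightarrow> n > (0::nat) \<Longrightarrow> x [^] n \<in> Z i \<Longrightarrow> x \<in> Z i"
  using torsion_free_Mod_Z Z.torsion_free_quot_iff by blast

lemma Z_coset_mono:
  assumes "i \<le> j" "x \<in> carrier G" "y \<in> carrier G" "Z i #> x = Z i #> y"
  shows "Z j #> x = Z j #> y"
  using assms Z_mono Z.r_coset_eq_iff by blast

lemma finite_Z_cosets_mono:
  assumes fin: "finite ((\<lambda>x. Z i #> f x) ` A)" and "i \<le> j" and f: "f \<in> A \<rightarrow> carrier G"
  shows "finite ((\<lambda>x. Z j #> f x) ` A)"
proof -
  have "\<exists>h. \<forall>x. x \<in> A \<longrightarrow> Z j #> f x = h (Z i #> f x)"
    using Z_coset_mono[OF assms(2)] f unfolding function_factors_left_gen[symmetric] by blast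
  then obtain h where "\<And>x. x \<in> A \<Longrightarrow> Z j #> f x = h (Z i #> f x)" by blast
  then have "(\<lambda>x. Z j #> f x) ` A \<subseteq> h ` (\<lambda>x. Z i #> f x) ` A" by auto
  then show ?thesis using fin finite_subset by blast
qed

lemma conj_permutes_generators_imp_mem_Z_Suc:
  assumes e: "e \<in> carrier G" and conj: "\<And>s. s \<in> S \<Longrightarrow> Z i #> (inv e \<otimes> s \<otimes> e) \<in> (#>) (Z i) ` S"
  shows "e \<in> Z (Suc i)"
proof -
  have "\<exists>k > 0. (Z i #> e) [^]\<^bsub>G Mod Z i\<^esub> (k::nat) \<in> center (G Mod Z i)"
  proof (rule Z.quot.H.pow_mem_center_if_conj_permutes)
    show "generate (G Mod Z i) ((#>) (Z i) ` S) = carrier (G Mod Z i)"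
      using Z.quot.generate_img[OF S_subset] by (simp add: generate_S carrier_FactGroup)
    show "(#>) (Z i) ` S \<subseteq> carrier (G Mod Z i)" using S_subset by auto
    fix t assume "t \<in> (#>) (Z i) ` S"
    then obtain s where "s \<in> S" "t = Z i #> s" by blast
    then show "inv\<^bsub>G Mod Z i\<^esub> (Z i #> e) \<otimes>\<^bsub>G Mod Z i\<^esub> t \<otimes>\<^bsub>G Mod Z i\<^esub> (Z i #> e) \<in> (#>) (Z i) ` S"
      using conj[of s] e by simp
  qed (use finite_S e in auto)
  then obtain k :: nat where k: "k > 0" "e [^] k \<in> Z (Suc i)"
    using e unfolding mem_Z_Suc_iff by (auto simp: Z.quot.hom_nat_pow)
  show ?thesis by (rule mem_Z_if_pow_mem[OF e k])
qed

end

locale cayley_automorphism = fg_nilpotent_group +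
  fixes \<psi> :: "'a \<Rightarrow> 'a"
  assumes automorphism: "graph_isomorphism (Cay G S) (Cay G S) \<psi>"
begin

lemma closed [simp]: "x \<in> carrier G \<Longrightarrow> \<psi> x \<in> carrier G"
  using automorphism bij_betw_apply unfolding graph_isomorphism_def by fastforce

lemma neighbours_bij: "x \<in> carrier G \<Longrightarrow> bij_betw (\<lambda>s. inv (\<psi> x) \<otimes> \<psi> (x \<otimes> s)) S S"
  using graph_isomorphism_Cay_bij_betw[OF is_group S_subset is_group S_subset automorphism] .

lemma translation_imp_mem_Z_Suc:
  assumes transl: "\<And>x. x \<in> carrier G \<Longrightarrow> Z i #> \<psi> x = Z i #> (x \<otimes> \<psi> \<one>)"
  shows "\<psi> \<one> \<in> Z (Suc i)"
proof (rule conj_permutes_generators_imp_mem_Z_Suc)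
  fix s assume s: "s \<in> S"
  have "Z i #> (inv (\<psi> \<one>) \<otimes> s \<otimes> \<psi> \<one>) = Z i #> (inv (\<psi> \<one>) \<otimes> \<psi> s)"
    using transl[of s] s by (simp add: m_assoc)
  moreover have "inv (\<psi> \<one>) \<otimes> \<psi> s \<in> S" using bij_betw_apply[OF neighbours_bij s, of \<one>] s by simp
  ultimately show "Z i #> (inv (\<psi> \<one>) \<otimes> s \<otimes> \<psi> \<one>) \<in> (#>) (Z i) ` S" by (rule image_eqI)
qed simp

definition defect :: "nat \<Rightarrow> 'a \<Rightarrow> 'a set" where
  "defect i x = Z i #> (inv (x \<otimes> \<psi> \<one>) \<otimes> \<psi> x)"

lemma defect_closed [simp]: "x \<in> carrier G \<Longrightarrow> defect i x \<in> carrier (G Mod Z i)"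
  unfolding defect_def by (intro Z.quot.hom_closed) simp

lemma coset_eq_mult_defect:
  "x \<in> carrier G \<Longrightarrow> Z i #> \<psi> x = (Z i #> x) \<otimes>\<^bsub>G Mod Z i\<^esub> (Z i #> \<psi> \<one>) \<otimes>\<^bsub>G Mod Z i\<^esub> defect i x"
  by (simp add: defect_def m_assoc flip: Z.quot.hom_mult)

lemma finite_defect:
  assumes "finite ((\<lambda>x. Z i #> (inv x \<otimes> \<psi> x)) ` carrier G)"
  shows "finite (defect i ` carrier G)"
proof -
  have "defect i ` carrier G \<subseteq>
      (\<lambda>X. inv\<^bsub>G Mod Z i\<^esub> (Z i #> \<psi> \<one>) \<otimes>\<^bsub>G Mod Z i\<^esub> X) ` (\<lambda>x. Z i #> (inv x \<otimes> \<psi> x)) ` carrier G"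
    by (auto simp: defect_def inv_mult_group Z.quot.H.m_assoc)
  then show ?thesis using assms finite_subset by blast
qed

context
  fixes i
  assumes translation_Suc: "\<And>x. x \<in> carrier G \<Longrightarrow> Z (Suc i) #> \<psi> x = Z (Suc i) #> (x \<otimes> \<psi> \<one>)"
begin

lemma defect_mem_center: "x \<in> carrier G \<Longrightarrow> defect i x \<in> center (G Mod Z i)"
  using translation_Suc[of x] Z.r_coset_eq_iff[of "x \<otimes> \<psi> \<one>" "\<psi> x" "Suc i"]
  unfolding defect_def mem_Z_Suc_iff by simp

lemma defect_harmonic:
  assumes x: "x \<in> carrier G"
  shows "finprod (center_group (G Mod Z i)) (\<lambda>s. defect i (x \<otimes> s)) S =
    defect i x [^]\<^bsub>center_group (G Mod Z i)\<^esub> card S"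
proof -
  let ?Q = "G Mod Z i" and ?p = "(#>) (Z i)"
  have "\<psi> \<one> \<in> Z (Suc (Suc i))" by (rule translation_imp_mem_Z_Suc[OF translation_Suc])
  then have e: "?p (\<psi> \<one>) \<in> central_modulo ?Q (center ?Q)"
    by (intro Z.r_coset_mem_central_modulo_center) (simp add: upper_central_series.simps)
  show ?thesis
  proof (rule Z.quot.H.finprod_central_displacement[OF torsion_free_Mod_Z bij_betw_inv_S
        neighbours_bij[OF x] _ _ e defect_mem_center[OF x]])
    fix s assume s: "s \<in> S"
    have "?p (inv (\<psi> x) \<otimes> \<psi> (x \<otimes> s)) = inv\<^bsub>?Q\<^esub> ?p (\<psi> x) \<otimes>\<^bsub>?Q\<^esub> ?p (\<psi> (x \<otimes> s))"
      using x s by simp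
    also have "\<dots> = inv\<^bsub>?Q\<^esub> defect i x \<otimes>\<^bsub>?Q\<^esub>
        (inv\<^bsub>?Q\<^esub> ?p (\<psi> \<one>) \<otimes>\<^bsub>?Q\<^esub> ?p s \<otimes>\<^bsub>?Q\<^esub> ?p (\<psi> \<one>)) \<otimes>\<^bsub>?Q\<^esub> defect i (x \<otimes> s)"
      unfolding coset_eq_mult_defect[OF x] coset_eq_mult_defect[OF m_closed[OF x S_closed[OF s]]]
      using x s by (simp add: Z.quot.H.inv_mult_group Z.quot.H.m_assoc)
    finally show "?p (inv (\<psi> x) \<otimes> \<psi> (x \<otimes> s)) = inv\<^bsub>?Q\<^esub> defect i x \<otimes>\<^bsub>?Q\<^esub>
        (inv\<^bsub>?Q\<^esub> ?p (\<psi> \<one>) \<otimes>\<^bsub>?Q\<^esub> ?p s \<otimes>\<^bsub>?Q\<^esub> ?p (\<psi> \<one>)) \<otimes>\<^bsub>?Q\<^esub> defect i (x \<otimes> s)" .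
  qed (use x defect_mem_center in auto)
qed

lemma translation_if_translation_Suc:
  assumes bounded: "finite ((\<lambda>x. Z i #> (inv x \<otimes> \<psi> x)) ` carrier G)" and x: "x \<in> carrier G"
  shows "Z i #> \<psi> x = Z i #> (x \<otimes> \<psi> \<one>)"
proof -
  let ?Q = "G Mod Z i"
  have "torsion_free (center_group ?Q)"
    by (intro Z.quot.H.torsion_free_subgroup torsion_free_Mod_Z Z.quot.H.centralizer_subgroup) simp
  then have "defect i x = defect i \<one>"
    by (rule harmonic_imp_constant[OF generators Z.quot.H.center_comm_group])
      (use finite_defect[OF bounded] defect_mem_center defect_harmonic x in simp_all)
  also have "defect i \<one> = \<one>\<^bsub>?Q\<^esub>" by (simp add: defect_def)
  finally show ?thesis using coset_eq_mult_defect[OF x, of i] x by simp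
qed

end

theorem translation_if_bounded:
  assumes bounded: "finite ((\<lambda>x. Z i #> (inv x \<otimes> \<psi> x)) ` carrier G)" and x: "x \<in> carrier G"
  shows "Z i #> \<psi> x = Z i #> (x \<otimes> \<psi> \<one>)"
proof -
  obtain n where "i \<le> n" and n: "Z n = carrier G" using Z_eq_carrier by blast
  from \<open>i \<le> n\<close> have "\<forall>x \<in> carrier G. Z i #> \<psi> x = Z i #> (x \<otimes> \<psi> \<one>)"
  proof (rule inc_induct)
    have "inv (\<psi> x) \<otimes> (x \<otimes> \<psi> \<one>) \<in> Z n" if "x \<in> carrier G" for x
      unfolding n using that by simp
    then show "\<forall>x \<in> carrier G. Z n #> \<psi> x = Z n #> (x \<otimes> \<psi> \<one>)"
      by (intro ballI Z.r_coset_eq_iff[THEN iffD2]) auto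
    fix j assume "i \<le> j" and Suc: "\<forall>x \<in> carrier G. Z (Suc j) #> \<psi> x = Z (Suc j) #> (x \<otimes> \<psi> \<one>)"
    from bounded \<open>i \<le> j\<close> have fin: "finite ((\<lambda>x. Z j #> (inv x \<otimes> \<psi> x)) ` carrier G)"
      by (rule finite_Z_cosets_mono) simp
    show "\<forall>x \<in> carrier G. Z j #> \<psi> x = Z j #> (x \<otimes> \<psi> \<one>)"
      by (intro ballI, rule translation_if_translation_Suc[OF _ fin]) (use Suc in blast)+
  qed
  then show ?thesis using x by blast
qed

end

section \<open>Isomorphisms of Cayley graphs\<close>

lemma (in group_hom) the_elem_image_kernel_coset:
  assumes x: "x \<in> carrier G"
  shows "the_elem (h ` (kernel G H h #> x)) = h x"
proof (rule the_elem_image_unique)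
  show "kernel G H h #> x \<noteq> {}" using G.rcos_self[OF x subgroup_kernel] by blast
  show "h y = h x" if "y \<in> kernel G H h #> x" for y
    using that x unfolding r_coset_def kernel_def by auto
qed

lemma (in group) induces_affine_bijection_if_hom:
  assumes N: "N \<lhd> G" and H: "group H" and M: "M \<lhd> H"
    and f: "f ` carrier G = carrier H"
    and hom: "\<And>x y. x \<in> carrier G \<Longrightarrow> y \<in> carrier G \<Longrightarrow>
      M #>\<^bsub>H\<^esub> f (x \<otimes> y) = M #>\<^bsub>H\<^esub> (f x \<otimes>\<^bsub>H\<^esub> inv\<^bsub>H\<^esub> f \<one> \<otimes>\<^bsub>H\<^esub> f y)"
    and ker: "\<And>x. x \<in> carrier G \<Longrightarrow> M #>\<^bsub>H\<^esub> f x = M #>\<^bsub>H\<^esub> f \<one> \<longleftrightarrow> x \<in> N"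
  shows "\<exists>F. (\<forall>x \<in> carrier G. F (N #> x) = M #>\<^bsub>H\<^esub> f x) \<and> affine_bijection (G Mod N) (H Mod M) F"
proof -
  interpret N: normal N G by (rule N)
  interpret M: normal M H by (rule M)
  let ?Q = "H Mod M" and ?p = "r_coset H M"
  have f_closed: "f x \<in> carrier H" if "x \<in> carrier G" for x using that f by blast
  define \<alpha> where "\<alpha> x = inv\<^bsub>?Q\<^esub> ?p (f \<one>) \<otimes>\<^bsub>?Q\<^esub> ?p (f x)" for x
  interpret \<alpha>: group_hom G ?Q \<alpha>
    by unfold_locales (auto intro!: homI simp: f_closed \<alpha>_def hom M.quot.H.m_assoc)
  have coset_f: "?p (f x) = ?p (f \<one>) \<otimes>\<^bsub>?Q\<^esub> \<alpha> x" if "x \<in> carrier G" for x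
    using f_closed that by (simp add: \<alpha>_def)
  have "\<alpha> x = \<one>\<^bsub>?Q\<^esub> \<longleftrightarrow> x \<in> N" if x: "x \<in> carrier G" for x
    using ker[OF x] x f_closed coset_f[OF x] M.quot.H.l_cancel_one[of "?p (f \<one>)" "\<alpha> x"] by simp
  then have ker_\<alpha>: "kernel G ?Q \<alpha> = N" using N.subset unfolding kernel_def by blast
  have "\<alpha> ` carrier G = (\<lambda>X. inv\<^bsub>?Q\<^esub> ?p (f \<one>) \<otimes>\<^bsub>?Q\<^esub> X) ` ?p ` f ` carrier G"
    unfolding \<alpha>_def by (simp add: image_image)
  also have "\<dots> = carrier ?Q"
    using f_closed M.quot.H.surj_const_mult by (simp add: f flip: carrier_FactGroup)
  finally have "(\<lambda>X. the_elem (\<alpha> ` X)) \<in> iso (G Mod kernel G ?Q \<alpha>) ?Q"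
    by (rule \<alpha>.FactGroup_iso_set)
  then have iso: "(\<lambda>X. the_elem (\<alpha> ` X)) \<in> iso (G Mod N) ?Q" unfolding ker_\<alpha> .
  define F where "F X = ?p (f \<one>) \<otimes>\<^bsub>?Q\<^esub> the_elem (\<alpha> ` X)" for X
  have "affine_bijection (G Mod N) ?Q F"
    unfolding affine_bijection_def
    using f_closed by (intro bexI[OF _ iso] bexI[of _ "?p (f \<one>)"]) (simp_all add: F_def)
  moreover have "F (N #> x) = ?p (f x)" if "x \<in> carrier G" for x
    using that coset_f[OF that] \<alpha>.the_elem_image_kernel_coset[OF that] unfolding ker_\<alpha> by (simp add: F_def)
  ultimately show ?thesis by blast
qed

locale cayley_isomorphism = G1: fg_nilpotent_group G1 S1 + G2: fg_nilpotent_group G2 S2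
  for G1 :: "('a, 'c) monoid_scheme" and S1 :: "'a set"
    and G2 :: "('b, 'd) monoid_scheme" and S2 :: "'b set" +
  fixes \<phi> :: "'a \<Rightarrow> 'b"
  assumes isomorphism: "graph_isomorphism (Cay G1 S1) (Cay G2 S2) \<phi>"
begin

lemma bij: "bij_betw \<phi> (carrier G1) (carrier G2)"
  using isomorphism unfolding graph_isomorphism_def by simp

lemma closed [simp]: "x \<in> carrier G1 \<Longrightarrow> \<phi> x \<in> carrier G2"
  using bij by (rule bij_betw_apply)

abbreviation \<phi>_inv :: "'b \<Rightarrow> 'a" where "\<phi>_inv \<equiv> inv_into (carrier G1) \<phi>"

lemma inv_closed [simp]: "y \<in> carrier G2 \<Longrightarrow> \<phi>_inv y \<in> carrier G1"
  using bij_betw_inv_into[OF bij] by (rule bij_betw_apply)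

lemma \<phi>_\<phi>_inv [simp]: "y \<in> carrier G2 \<Longrightarrow> \<phi> (\<phi>_inv y) = y"
  using bij by (rule bij_betw_inv_into_right)

lemma \<phi>_inv_\<phi> [simp]: "x \<in> carrier G1 \<Longrightarrow> \<phi>_inv (\<phi> x) = x"
  using bij by (rule bij_betw_inv_into_left)

lemma inverse_isomorphism: "graph_isomorphism (Cay G2 S2) (Cay G1 S1) \<phi>_inv"
  using graph_isomorphism_inv_into[OF isomorphism] by simp

lemma inverse_cayley_isomorphism: "cayley_isomorphism G2 S2 G1 S1 \<phi>_inv"
  by unfold_locales (rule inverse_isomorphism)

definition shift :: "'a \<Rightarrow> 'a \<Rightarrow> 'b" where
  "shift x w = inv\<^bsub>G2\<^esub> \<phi> x \<otimes>\<^bsub>G2\<^esub> \<phi> (x \<otimes>\<^bsub>G1\<^esub> w)"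

lemma shift_closed [simp]: "x \<in> carrier G1 \<Longrightarrow> w \<in> carrier G1 \<Longrightarrow> shift x w \<in> carrier G2"
  by (simp add: shift_def)

lemma mult_shift: "x \<in> carrier G1 \<Longrightarrow> w \<in> carrier G1 \<Longrightarrow> \<phi> x \<otimes>\<^bsub>G2\<^esub> shift x w = \<phi> (x \<otimes>\<^bsub>G1\<^esub> w)"
  by (simp add: shift_def)

lemma shift_mult:
  "x \<in> carrier G1 \<Longrightarrow> v \<in> carrier G1 \<Longrightarrow> w \<in> carrier G1 \<Longrightarrow>
    shift x (v \<otimes>\<^bsub>G1\<^esub> w) = shift x v \<otimes>\<^bsub>G2\<^esub> shift (x \<otimes>\<^bsub>G1\<^esub> v) w"
  by (simp add: shift_def G1.m_assoc G2.m_assoc)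

lemma shift_bij_betw: "x \<in> carrier G1 \<Longrightarrow> bij_betw (shift x) S1 S2"
  unfolding shift_def
  using graph_isomorphism_Cay_bij_betw[OF G1.is_group G1.S_subset G2.is_group G2.S_subset isomorphism] .

lemma finite_shifts:
  assumes "w \<in> carrier G1"
  shows "finite ((\<lambda>x. shift x w) ` carrier G1)"
  using G1.generators assms
proof (rule G1.symmetric_generating_induct)
  have "(\<lambda>x. shift x \<one>\<^bsub>G1\<^esub>) ` carrier G1 \<subseteq> {\<one>\<^bsub>G2\<^esub>}" by (auto simp: shift_def)
  then show "finite ((\<lambda>x. shift x \<one>\<^bsub>G1\<^esub>) ` carrier G1)" by (rule finite_subset) simp
next
  fix h s assume h: "h \<in> carrier G1" and s: "s \<in> S1" and IH: "finite ((\<lambda>x. shift x h) ` carrier G1)"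
  have "shift x (h \<otimes>\<^bsub>G1\<^esub> s) \<in> (\<lambda>x. shift x h) ` carrier G1 <#>\<^bsub>G2\<^esub> S2" if x: "x \<in> carrier G1" for x
  proof -
    have "shift (x \<otimes>\<^bsub>G1\<^esub> h) s \<in> S2" using bij_betw_apply[OF shift_bij_betw s] x h by simp
    then show ?thesis using x h s by (auto simp: shift_mult set_mult_def)
  qed
  then have "(\<lambda>x. shift x (h \<otimes>\<^bsub>G1\<^esub> s)) ` carrier G1 \<subseteq> (\<lambda>x. shift x h) ` carrier G1 <#>\<^bsub>G2\<^esub> S2"
    by blast
  moreover have "finite ((\<lambda>x. shift x h) ` carrier G1 <#>\<^bsub>G2\<^esub> S2)"
    unfolding set_mult_def by (intro finite_UN_I IH G2.finite_S) simp
  ultimately show "finite ((\<lambda>x. shift x (h \<otimes>\<^bsub>G1\<^esub> s)) ` carrier G1)" by (rule finite_subset)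
qed

lemma left_translation_automorphism:
  assumes "g \<in> carrier G1"
  shows "cayley_automorphism G2 S2 (\<lambda>y. \<phi> (g \<otimes>\<^bsub>G1\<^esub> \<phi>_inv y))"
proof unfold_locales
  note G1.graph_isomorphism_left_translation[OF G1.S_subset assms]
  from graph_isomorphism_comp[OF graph_isomorphism_comp[OF inverse_isomorphism this] isomorphism]
  show "graph_isomorphism (Cay G2 S2) (Cay G2 S2) (\<lambda>y. \<phi> (g \<otimes>\<^bsub>G1\<^esub> \<phi>_inv y))"
    by (simp add: comp_def)
qed

definition bounded_left_translation :: "nat \<Rightarrow> 'a \<Rightarrow> bool" where
  "bounded_left_translation i g \<longleftrightarrow>
    finite ((\<lambda>x. G2.Z i #>\<^bsub>G2\<^esub> (inv\<^bsub>G2\<^esub> \<phi> x \<otimes>\<^bsub>G2\<^esub> \<phi> (g \<otimes>\<^bsub>G1\<^esub> x))) ` carrier G1)"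

lemma
  assumes g: "g \<in> carrier G1" and bounded: "bounded_left_translation i g"
  shows shift_one_mem_Z_Suc_if_bounded: "shift \<one>\<^bsub>G1\<^esub> g \<in> G2.Z (Suc i)"
    and left_translation_if_bounded: "x \<in> carrier G1 \<Longrightarrow>
      G2.Z i #>\<^bsub>G2\<^esub> \<phi> (g \<otimes>\<^bsub>G1\<^esub> x) = G2.Z i #>\<^bsub>G2\<^esub> (\<phi> x \<otimes>\<^bsub>G2\<^esub> shift \<one>\<^bsub>G1\<^esub> g)"
proof -
  define e where "e = \<phi> (g \<otimes>\<^bsub>G1\<^esub> \<phi>_inv \<one>\<^bsub>G2\<^esub>)"
  interpret \<psi>: cayley_automorphism G2 S2 "\<lambda>y. \<phi> (g \<otimes>\<^bsub>G1\<^esub> \<phi>_inv y)"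
    by (rule left_translation_automorphism[OF g])
  have e: "e \<in> carrier G2" unfolding e_def using g by simp
  have "(\<lambda>y. G2.Z i #>\<^bsub>G2\<^esub> (inv\<^bsub>G2\<^esub> y \<otimes>\<^bsub>G2\<^esub> \<phi> (g \<otimes>\<^bsub>G1\<^esub> \<phi>_inv y))) ` carrier G2 =
      (\<lambda>x. G2.Z i #>\<^bsub>G2\<^esub> (inv\<^bsub>G2\<^esub> \<phi> x \<otimes>\<^bsub>G2\<^esub> \<phi> (g \<otimes>\<^bsub>G1\<^esub> x))) ` carrier G1"
    unfolding bij_betw_imp_surj_on[OF bij, symmetric] image_image by (intro image_cong) simp_all
  then have "finite ((\<lambda>y. G2.Z i #>\<^bsub>G2\<^esub> (inv\<^bsub>G2\<^esub> y \<otimes>\<^bsub>G2\<^esub> \<phi> (g \<otimes>\<^bsub>G1\<^esub> \<phi>_inv y))) ` carrier G2)"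
    using bounded unfolding bounded_left_translation_def by simp
  note transl_\<psi> = \<psi>.translation_if_bounded[OF this]
  have transl: "G2.Z i #>\<^bsub>G2\<^esub> \<phi> (g \<otimes>\<^bsub>G1\<^esub> x) = G2.Z i #>\<^bsub>G2\<^esub> (\<phi> x \<otimes>\<^bsub>G2\<^esub> e)" if "x \<in> carrier G1" for x
    using transl_\<psi>[of "\<phi> x"] that unfolding e_def by simp
  have "e \<in> G2.Z (Suc i)" unfolding e_def using transl_\<psi> by (rule \<psi>.translation_imp_mem_Z_Suc)
  moreover have shift_eq: "G2.Z i #>\<^bsub>G2\<^esub> shift \<one>\<^bsub>G1\<^esub> g = G2.Z i #>\<^bsub>G2\<^esub> e"
    using transl[of "\<one>\<^bsub>G1\<^esub>"] g e by (simp add: shift_def)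
  ultimately show "shift \<one>\<^bsub>G1\<^esub> g \<in> G2.Z (Suc i)" using g e by (simp add: G2.mem_Z_Suc_iff)
  show "G2.Z i #>\<^bsub>G2\<^esub> \<phi> (g \<otimes>\<^bsub>G1\<^esub> x) = G2.Z i #>\<^bsub>G2\<^esub> (\<phi> x \<otimes>\<^bsub>G2\<^esub> shift \<one>\<^bsub>G1\<^esub> g)" if "x \<in> carrier G1"
    using transl[OF that] shift_eq g e that by simp
qed

text \<open>A torsion element \<open>g\<close> has only finitely many conjugates, so that the conjugate \<open>\<phi> L\<^sub>g \<phi>\<^sup>-\<^sup>1\<close> of the
  left translation by \<open>g\<close> has bounded displacement; having finite order, it is trivial modulo torsion.\<close>

lemma bounded_left_translation_torsion:
  assumes g: "g \<in> G1.Z 0"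
  shows "bounded_left_translation i g"
proof -
  have g_carrier: "g \<in> carrier G1" using g by simp
  have conj: "inv\<^bsub>G2\<^esub> \<phi> x \<otimes>\<^bsub>G2\<^esub> \<phi> (g \<otimes>\<^bsub>G1\<^esub> x) \<in> (\<Union>n\<in>G1.Z 0. (\<lambda>x. shift x n) ` carrier G1)"
    if x: "x \<in> carrier G1" for x
  proof -
    have "inv\<^bsub>G2\<^esub> \<phi> x \<otimes>\<^bsub>G2\<^esub> \<phi> (g \<otimes>\<^bsub>G1\<^esub> x) = shift x (inv\<^bsub>G1\<^esub> x \<otimes>\<^bsub>G1\<^esub> g \<otimes>\<^bsub>G1\<^esub> x)"
      using x g_carrier by (simp add: shift_def G1.m_assoc)
    moreover have "inv\<^bsub>G1\<^esub> x \<otimes>\<^bsub>G1\<^esub> g \<otimes>\<^bsub>G1\<^esub> x \<in> G1.Z 0" using x g by (rule G1.Z.inv_op_closed1)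
    ultimately show ?thesis using x by blast
  qed
  have "finite (\<Union>n\<in>G1.Z 0. (\<lambda>x. shift x n) ` carrier G1)"
    using G1.finite_Z_0 by (intro finite_UN_I finite_shifts) simp_all
  then have "finite (r_coset G2 (G2.Z i) ` (\<Union>n\<in>G1.Z 0. (\<lambda>x. shift x n) ` carrier G1))"
    by (rule finite_imageI)
  then show ?thesis
    unfolding bounded_left_translation_def
    by (rule rev_finite_subset) (intro image_subsetI imageI conj)
qed

lemma shift_one_torsion:
  assumes g: "g \<in> G1.Z 0"
  shows "shift \<one>\<^bsub>G1\<^esub> g \<in> G2.Z 0"
proof -
  have g_carrier: "g \<in> carrier G1" using g by simp
  define e where "e = shift \<one>\<^bsub>G1\<^esub> g"
  have e: "e \<in> carrier G2" unfolding e_def using g_carrier by simp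
  have pow: "G2.Z 0 #>\<^bsub>G2\<^esub> \<phi> (g [^]\<^bsub>G1\<^esub> m) = G2.Z 0 #>\<^bsub>G2\<^esub> (\<phi> \<one>\<^bsub>G1\<^esub> \<otimes>\<^bsub>G2\<^esub> e [^]\<^bsub>G2\<^esub> m)" for m :: nat
  proof (induction m)
    case (Suc m)
    have "G2.Z 0 #>\<^bsub>G2\<^esub> \<phi> (g [^]\<^bsub>G1\<^esub> Suc m) = G2.Z 0 #>\<^bsub>G2\<^esub> (\<phi> (g [^]\<^bsub>G1\<^esub> m) \<otimes>\<^bsub>G2\<^esub> e)"
      unfolding G1.nat_pow_Suc2[OF g_carrier] e_def
      using g_carrier by (intro left_translation_if_bounded bounded_left_translation_torsion g) simp_all
    also have "\<dots> = G2.Z 0 #>\<^bsub>G2\<^esub> (\<phi> \<one>\<^bsub>G1\<^esub> \<otimes>\<^bsub>G2\<^esub> e [^]\<^bsub>G2\<^esub> Suc m)"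
      using Suc g_carrier e by (simp add: G2.Z.quot.H.m_assoc)
    finally show ?case .
  qed simp
  obtain m :: nat where m: "m > 0" "g [^]\<^bsub>G1\<^esub> m = \<one>\<^bsub>G1\<^esub>"
    using g unfolding upper_central_series.simps torsion_subgroup_def by blast
  then have "e [^]\<^bsub>G2\<^esub> m \<in> G2.Z 0"
    using pow[of m] e G2.Z.r_coset_eq_one_iff[of "e [^]\<^bsub>G2\<^esub> m"] by simp
  then show ?thesis unfolding e_def[symmetric] by (rule G2.mem_Z_if_pow_mem[OF e m(1)])
qed

lemma shift_torsion:
  assumes n: "n \<in> G1.Z 0" and x: "x \<in> carrier G1"
  shows "shift x n \<in> G2.Z 0"
proof -
  let ?g = "x \<otimes>\<^bsub>G1\<^esub> n \<otimes>\<^bsub>G1\<^esub> inv\<^bsub>G1\<^esub> x"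
  have g: "?g \<in> G1.Z 0" "?g \<in> carrier G1" using G1.Z.inv_op_closed2[OF x n] x n by auto
  have "G2.Z 0 #>\<^bsub>G2\<^esub> \<phi> (x \<otimes>\<^bsub>G1\<^esub> n) = G2.Z 0 #>\<^bsub>G2\<^esub> \<phi> (?g \<otimes>\<^bsub>G1\<^esub> x)"
    using n x by (simp add: G1.m_assoc)
  also have "\<dots> = G2.Z 0 #>\<^bsub>G2\<^esub> (\<phi> x \<otimes>\<^bsub>G2\<^esub> shift \<one>\<^bsub>G1\<^esub> ?g)"
    by (intro left_translation_if_bounded bounded_left_translation_torsion g x)
  also have "\<dots> = G2.Z 0 #>\<^bsub>G2\<^esub> \<phi> x"
    using x shift_one_torsion[OF g(1)] by (intro G2.Z.r_coset_mult_mem) simp_all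
  finally show ?thesis using n x G2.Z.r_coset_eq_iff[of "\<phi> x" "\<phi> (x \<otimes>\<^bsub>G1\<^esub> n)" 0] by (simp add: shift_def)
qed

definition uniform_shift :: "nat \<Rightarrow> 'a \<Rightarrow> bool" where
  "uniform_shift i w \<longleftrightarrow>
    (\<forall>x \<in> carrier G1. G2.Z i #>\<^bsub>G2\<^esub> shift x w = G2.Z i #>\<^bsub>G2\<^esub> shift \<one>\<^bsub>G1\<^esub> w)"

lemma uniform_shiftD:
  "uniform_shift i w \<Longrightarrow> x \<in> carrier G1 \<Longrightarrow> G2.Z i #>\<^bsub>G2\<^esub> shift x w = G2.Z i #>\<^bsub>G2\<^esub> shift \<one>\<^bsub>G1\<^esub> w"
  unfolding uniform_shift_def by blast

lemma uniform_shift_one: "uniform_shift i \<one>\<^bsub>G1\<^esub>"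
  by (simp add: uniform_shift_def shift_def)

lemma uniform_shift_mult:
  assumes v: "uniform_shift i v" "v \<in> carrier G1" and w: "uniform_shift i w" "w \<in> carrier G1"
  shows "uniform_shift i (v \<otimes>\<^bsub>G1\<^esub> w)"
  unfolding uniform_shift_def
proof
  fix x assume x: "x \<in> carrier G1"
  then show "G2.Z i #>\<^bsub>G2\<^esub> shift x (v \<otimes>\<^bsub>G1\<^esub> w) = G2.Z i #>\<^bsub>G2\<^esub> shift \<one>\<^bsub>G1\<^esub> (v \<otimes>\<^bsub>G1\<^esub> w)"
    using v(2) w(2) uniform_shiftD[OF v(1) x] uniform_shiftD[OF w(1), of "x \<otimes>\<^bsub>G1\<^esub> v"]
      uniform_shiftD[OF w(1) v(2)]
    by (simp add: shift_mult)
qed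

lemma
  assumes shift_Z: "\<And>x k. x \<in> carrier G1 \<Longrightarrow> k \<in> G1.Z i \<Longrightarrow> shift x k \<in> G2.Z i"
    and g: "g \<in> G1.Z (Suc i)"
  shows shift_one_mem_Z_Suc: "shift \<one>\<^bsub>G1\<^esub> g \<in> G2.Z (Suc i)"
    and uniform_shift_Z_Suc: "uniform_shift i g"
proof -
  have g_carrier: "g \<in> carrier G1" using g by simp
  have commute: "G2.Z i #>\<^bsub>G2\<^esub> \<phi> (g \<otimes>\<^bsub>G1\<^esub> x) = G2.Z i #>\<^bsub>G2\<^esub> \<phi> (x \<otimes>\<^bsub>G1\<^esub> g)" if x: "x \<in> carrier G1" for x
  proof -
    define k where "k = inv\<^bsub>G1\<^esub> (x \<otimes>\<^bsub>G1\<^esub> g) \<otimes>\<^bsub>G1\<^esub> (g \<otimes>\<^bsub>G1\<^esub> x)"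
    have k: "k \<in> G1.Z i"
      using G1.Z_coset_commute[OF g x] x g_carrier G1.Z.r_coset_eq_iff[of "x \<otimes>\<^bsub>G1\<^esub> g" "g \<otimes>\<^bsub>G1\<^esub> x" i]
      unfolding k_def by simp
    then have "\<phi> (g \<otimes>\<^bsub>G1\<^esub> x) = \<phi> (x \<otimes>\<^bsub>G1\<^esub> g) \<otimes>\<^bsub>G2\<^esub> shift (x \<otimes>\<^bsub>G1\<^esub> g) k"
      using x g_carrier unfolding k_def by (simp add: mult_shift)
    then show ?thesis using x g_carrier k shift_Z by (simp add: G2.Z.r_coset_mult_mem del: G2.Z.quot.hom_mult)
  qed
  have "(\<lambda>x. G2.Z i #>\<^bsub>G2\<^esub> (inv\<^bsub>G2\<^esub> \<phi> x \<otimes>\<^bsub>G2\<^esub> \<phi> (g \<otimes>\<^bsub>G1\<^esub> x))) ` carrier G1 =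
      (#>\<^bsub>G2\<^esub>) (G2.Z i) ` (\<lambda>x. shift x g) ` carrier G1"
    unfolding image_image using g_carrier by (intro image_cong) (simp_all add: shift_def commute)
  then have bounded: "bounded_left_translation i g"
    unfolding bounded_left_translation_def using finite_shifts[OF g_carrier] by simp
  show "shift \<one>\<^bsub>G1\<^esub> g \<in> G2.Z (Suc i)" by (rule shift_one_mem_Z_Suc_if_bounded[OF g_carrier bounded])
  show "uniform_shift i g"
    unfolding uniform_shift_def
  proof
    fix x assume x: "x \<in> carrier G1"
    show "G2.Z i #>\<^bsub>G2\<^esub> shift x g = G2.Z i #>\<^bsub>G2\<^esub> shift \<one>\<^bsub>G1\<^esub> g"
      using left_translation_if_bounded[OF g_carrier bounded x] x g_carrier
      by (simp add: commute shift_def[of x])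
  qed
qed

lemma shift_mem_Z: "x \<in> carrier G1 \<Longrightarrow> k \<in> G1.Z i \<Longrightarrow> shift x k \<in> G2.Z i"
proof (induction i arbitrary: x k)
  case 0
  then show ?case by (simp add: shift_torsion)
next
  case (Suc i)
  have "k \<in> carrier G1" using Suc.prems(2) by simp
  then show ?case
    using uniform_shiftD[OF uniform_shift_Z_Suc[OF Suc.IH Suc.prems(2)] Suc.prems(1)]
      shift_one_mem_Z_Suc[OF Suc.IH Suc.prems(2)] Suc.prems(1)
    by (simp add: G2.mem_Z_Suc_iff)
qed

lemma shift_mem_Z_iff:
  assumes x: "x \<in> carrier G1" and w: "w \<in> carrier G1"
  shows "shift x w \<in> G2.Z i \<longleftrightarrow> w \<in> G1.Z i"
proof
  interpret inverse: cayley_isomorphism G2 S2 G1 S1 \<phi>_inv by (rule inverse_cayley_isomorphism)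
  assume "shift x w \<in> G2.Z i"
  then have "inverse.shift (\<phi> x) (shift x w) \<in> G1.Z i" using x by (intro inverse.shift_mem_Z) simp_all
  then show "w \<in> G1.Z i" using x w by (simp add: inverse.shift_def mult_shift)
qed (use x shift_mem_Z in blast)

lemma coset_shift_eq_iff:
  assumes x: "x \<in> carrier G1" and v: "v \<in> carrier G1" and w: "w \<in> carrier G1"
  shows "G2.Z i #>\<^bsub>G2\<^esub> shift x v = G2.Z i #>\<^bsub>G2\<^esub> shift x w \<longleftrightarrow> G1.Z i #>\<^bsub>G1\<^esub> v = G1.Z i #>\<^bsub>G1\<^esub> w"
proof -
  have "shift x w = shift x v \<otimes>\<^bsub>G2\<^esub> shift (x \<otimes>\<^bsub>G1\<^esub> v) (inv\<^bsub>G1\<^esub> v \<otimes>\<^bsub>G1\<^esub> w)"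
    using x v w by (simp flip: shift_mult)
  then have "inv\<^bsub>G2\<^esub> shift x v \<otimes>\<^bsub>G2\<^esub> shift x w = shift (x \<otimes>\<^bsub>G1\<^esub> v) (inv\<^bsub>G1\<^esub> v \<otimes>\<^bsub>G1\<^esub> w)"
    using x v w by simp
  then show ?thesis
    using x v w by (simp add: G1.Z.r_coset_eq_iff G2.Z.r_coset_eq_iff shift_mem_Z_iff)
qed

lemma shift_bij_betw_coset:
  assumes s: "s \<in> carrier G1" and uniform: "uniform_shift i s" and x: "x \<in> carrier G1"
  shows "bij_betw (shift x) {s' \<in> S1. G1.Z i #>\<^bsub>G1\<^esub> s' = G1.Z i #>\<^bsub>G1\<^esub> s}
    {c \<in> S2. G2.Z i #>\<^bsub>G2\<^esub> c = G2.Z i #>\<^bsub>G2\<^esub> shift \<one>\<^bsub>G1\<^esub> s}"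
proof (rule bij_betw_Collect[OF shift_bij_betw[OF x]])
  fix s' assume "s' \<in> S1"
  then show "G2.Z i #>\<^bsub>G2\<^esub> shift x s' = G2.Z i #>\<^bsub>G2\<^esub> shift \<one>\<^bsub>G1\<^esub> s \<longleftrightarrow> G1.Z i #>\<^bsub>G1\<^esub> s' = G1.Z i #>\<^bsub>G1\<^esub> s"
    unfolding uniform_shiftD[OF uniform x, symmetric] by (intro coset_shift_eq_iff x s) simp
qed

text \<open>The shifts at \<open>x\<close> and at \<open>\<one>\<close> parametrize the same subset of \<open>S2\<close> and differ by a constant that
  is central modulo \<open>G2.Z i\<close>.\<close>

lemma uniform_shift_if_uniform_shift_Suc:
  assumes s: "s \<in> S1" and uniform: "uniform_shift (Suc i) s"
  shows "uniform_shift i s"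
  unfolding uniform_shift_def
proof
  fix x assume x: "x \<in> carrier G1"
  let ?Q = "G2 Mod G2.Z i" and ?p = "r_coset G2 (G2.Z i)"
  define F where "F = {s' \<in> S1. G1.Z (Suc i) #>\<^bsub>G1\<^esub> s' = G1.Z (Suc i) #>\<^bsub>G1\<^esub> s}"
  define z where "z = shift x s \<otimes>\<^bsub>G2\<^esub> inv\<^bsub>G2\<^esub> shift \<one>\<^bsub>G1\<^esub> s"
  have s_carrier: "s \<in> carrier G1" using s by simp
  have shifts_closed: "shift x s \<in> carrier G2" "shift \<one>\<^bsub>G1\<^esub> s \<in> carrier G2" using x s_carrier by simp_all
  have z_carrier: "z \<in> carrier G2" unfolding z_def using shifts_closed by simp
  have shift_eq: "shift x s = z \<otimes>\<^bsub>G2\<^esub> shift \<one>\<^bsub>G1\<^esub> s"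
    unfolding z_def using shifts_closed by (simp add: G2.m_assoc)
  have "z \<in> G2.Z (Suc i)"
    using uniform_shiftD[OF uniform x] shifts_closed G2.Z.r_coset_eq_one_iff[of z "Suc i"] by (simp add: z_def)
  then have z: "?p z \<in> center ?Q" by (simp add: G2.mem_Z_Suc_iff)
  have "?p z = \<one>\<^bsub>?Q\<^esub>"
  proof (rule G2.Z.quot.H.central_shift_eq_one[OF G2.torsion_free_Mod_Z _ _
        shift_bij_betw_coset[OF s_carrier uniform G1.one_closed] shift_bij_betw_coset[OF s_carrier uniform x] _ z,
        folded F_def])
    show "finite F" "F \<noteq> {}" using G1.finite_S s unfolding F_def by auto
    fix s' assume "s' \<in> F"
    then have s': "s' \<in> carrier G1" and w: "inv\<^bsub>G1\<^esub> s \<otimes>\<^bsub>G1\<^esub> s' \<in> G1.Z (Suc i)"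
      using s_carrier G1.Z.r_coset_eq_iff[of s s' "Suc i"] unfolding F_def by auto
    have "?p (shift y s') = ?p (shift y s) \<otimes>\<^bsub>?Q\<^esub> ?p (shift \<one>\<^bsub>G1\<^esub> (inv\<^bsub>G1\<^esub> s \<otimes>\<^bsub>G1\<^esub> s'))"
      if y: "y \<in> carrier G1" for y
    proof -
      have "shift y s' = shift y s \<otimes>\<^bsub>G2\<^esub> shift (y \<otimes>\<^bsub>G1\<^esub> s) (inv\<^bsub>G1\<^esub> s \<otimes>\<^bsub>G1\<^esub> s')"
        using y s_carrier s' by (simp flip: shift_mult)
      then show ?thesis
        using uniform_shiftD[OF uniform_shift_Z_Suc[OF shift_mem_Z w], of "y \<otimes>\<^bsub>G1\<^esub> s"] y s_carrier s' by simp
    qed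
    from this[OF x] this[OF G1.one_closed]
    show "?p (shift x s') = ?p z \<otimes>\<^bsub>?Q\<^esub> ?p (shift \<one>\<^bsub>G1\<^esub> s')"
      using shifts_closed s' s_carrier by (simp add: z_def G2.Z.quot.H.m_assoc)
  qed auto
  then show "?p (shift x s) = ?p (shift \<one>\<^bsub>G1\<^esub> s)"
    using shift_eq z_carrier shifts_closed by simp
qed

lemma uniform_shift:
  assumes "w \<in> carrier G1"
  shows "uniform_shift i w"
proof -
  obtain n where "i \<le> n" and n: "G2.Z n = carrier G2" using G2.Z_eq_carrier by blast
  from \<open>i \<le> n\<close> have "\<forall>w \<in> carrier G1. uniform_shift i w"
  proof (rule inc_induct)
    have "inv\<^bsub>G2\<^esub> shift x w \<otimes>\<^bsub>G2\<^esub> shift \<one>\<^bsub>G1\<^esub> w \<in> G2.Z n"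
      if "x \<in> carrier G1" "w \<in> carrier G1" for x w
      unfolding n using that by simp
    then show "\<forall>w \<in> carrier G1. uniform_shift n w"
      unfolding uniform_shift_def by (intro ballI G2.Z.r_coset_eq_iff[THEN iffD2]) auto
    fix j assume Suc: "\<forall>w \<in> carrier G1. uniform_shift (Suc j) w"
    show "\<forall>w \<in> carrier G1. uniform_shift j w"
    proof
      fix w assume "w \<in> carrier G1"
      with G1.generators show "uniform_shift j w"
      proof (rule G1.symmetric_generating_induct)
        fix h s assume h: "h \<in> carrier G1" "uniform_shift j h" and s: "s \<in> S1"
        have "uniform_shift j s" by (rule uniform_shift_if_uniform_shift_Suc[OF s]) (use Suc s in simp)
        then show "uniform_shift j (h \<otimes>\<^bsub>G1\<^esub> s)" using s by (intro uniform_shift_mult[OF h(2,1)]) simp_all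
      qed (rule uniform_shift_one)
    qed
  qed
  then show ?thesis using assms by blast
qed

theorem induces_affine_bijection:
  "\<exists>\<psi>. (\<forall>x \<in> carrier G1. \<psi> (G1.Z 0 #>\<^bsub>G1\<^esub> x) = G2.Z 0 #>\<^bsub>G2\<^esub> \<phi> x) \<and>
    affine_bijection (G1 Mod G1.Z 0) (G2 Mod G2.Z 0) \<psi>"
proof (rule G1.induces_affine_bijection_if_hom)
  show "\<phi> ` carrier G1 = carrier G2" using bij by (rule bij_betw_imp_surj_on)
  fix x assume x: "x \<in> carrier G1"
  show "G2.Z 0 #>\<^bsub>G2\<^esub> \<phi> x = G2.Z 0 #>\<^bsub>G2\<^esub> \<phi> \<one>\<^bsub>G1\<^esub> \<longleftrightarrow> x \<in> G1.Z 0"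
    using x G2.Z.r_coset_eq_iff[of "\<phi> \<one>\<^bsub>G1\<^esub>" "\<phi> x" 0] shift_mem_Z_iff[of "\<one>\<^bsub>G1\<^esub>" x 0]
    by (auto simp: shift_def)
  fix y assume y: "y \<in> carrier G1"
  have "G2.Z 0 #>\<^bsub>G2\<^esub> (\<phi> x \<otimes>\<^bsub>G2\<^esub> shift x y) = G2.Z 0 #>\<^bsub>G2\<^esub> (\<phi> x \<otimes>\<^bsub>G2\<^esub> shift \<one>\<^bsub>G1\<^esub> y)"
    using x y uniform_shiftD[OF uniform_shift[OF y] x] by simp
  then show "G2.Z 0 #>\<^bsub>G2\<^esub> \<phi> (x \<otimes>\<^bsub>G1\<^esub> y) = G2.Z 0 #>\<^bsub>G2\<^esub> (\<phi> x \<otimes>\<^bsub>G2\<^esub> inv\<^bsub>G2\<^esub> \<phi> \<one>\<^bsub>G1\<^esub> \<otimes>\<^bsub>G2\<^esub> \<phi> y)"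
    using x y by (simp add: shift_def G2.Z.quot.H.m_assoc)
qed (simp_all add: G1.Z_normal G2.Z_normal)

end

theorem theorem1p11:
  fixes G1 :: "('a, 'c) monoid_scheme" and G2 :: "('b, 'd) monoid_scheme"
    and S1 :: "'a set" and S2 :: "'b set"
    and N1 :: "'a set" and N2 :: "'b set"
    and \<phi> :: "'a \<Rightarrow> 'b"
  assumes "nilpotent_group G1" and "nilpotent_group G2"
    and "symmetric_finite_generating_set G1 S1" and "symmetric_finite_generating_set G2 S2"
    and "N1 = torsion_subgroup G1" and "N2 = torsion_subgroup G2"
    and "graph_isomorphism (Cay G1 S1) (Cay G2 S2) \<phi>"
  shows "finite N1 \<and> N1 \<lhd> G1 \<and> finite N2 \<and> N2 \<lhd> G2 \<and>
    (\<exists>\<psi> :: 'a set \<Rightarrow> 'b set.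
       (\<forall>x \<in> carrier G1. \<psi> (x <#\<^bsub>G1\<^esub> N1) = \<phi> x <#\<^bsub>G2\<^esub> N2) \<and>
       affine_bijection (G1 Mod N1) (G2 Mod N2) \<psi>)"
proof -
  have groups: "group G1" "group G2" using assms(1,2) unfolding nilpotent_group_def by auto
  interpret cayley_isomorphism G1 S1 G2 S2 \<phi>
    by (intro cayley_isomorphism.intro fg_nilpotent_group.intro fg_nilpotent_group_axioms.intro
        cayley_isomorphism_axioms.intro groups assms)
  have N: "N1 = G1.Z 0" "N2 = G2.Z 0" using assms(5,6) by (simp_all add: upper_central_series.simps)
  have "x <#\<^bsub>G1\<^esub> N1 = N1 #>\<^bsub>G1\<^esub> x" if "x \<in> carrier G1" for x
    using G1.Z.coset_eq that unfolding N by simp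
  moreover have "\<phi> x <#\<^bsub>G2\<^esub> N2 = N2 #>\<^bsub>G2\<^esub> \<phi> x" if "x \<in> carrier G1" for x
    using G2.Z.coset_eq that unfolding N by simp
  ultimately show ?thesis
    using induces_affine_bijection G1.finite_Z_0 G2.finite_Z_0 G1.Z_normal G2.Z_normal
    unfolding N by simp
qed

end
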